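(* Let $G$ be a connected unicyclic graph. Then $G$ is $\alpha$-excellent if and only if one of the following holds: (1) the plucked graph $P(G)$ of $G$ is a cycle; (2) the plucked graph $P(G)$ of $G$ is a caterpillar-wheel having a perfect matching and having $\ell$ legs, where $\ell\ge 2$.
   Context: All graphs are finite and simple. A graph is $\alpha$-excellent if every vertex is contained in some maximum independent set. A support vertex is a vertex adjacent to a vertex of degree $1$. The plucking operation: if a graph has order at least $4$ and contains a support vertex of degree $2$, remove this support vertex together with its unique neighbor of degree $1$. The plucked graph $P(G)$ is the graph obtained from $G$ by repeatedly applying the plucking operation until no further plucking operation is possible. A caterpillar-wheel is a connected unicyclic graph of girth at least three in which at least one end of every edge lies on the unique cycle; its legs are its end-edges (edges incident with a vertex of degree $1$). *)

theory Defs
  imports "Graph_Theory.Graph_Theory"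
begin

text \<open>
  As in the library, a finite simple graph is a symmetric, loop-free digraph without parallel
  arcs (locale \<^locale>\<open>graph\<close>): an undirected edge \<open>uv\<close> is the pair of arcs \<open>u \<rightarrow> v\<close>, \<open>v \<rightarrow> u\<close>.
  Hence the degree of a vertex is its \<^const>\<open>out_degree\<close>, and edges are recovered as two-element
  sets.
\<close>

definition edges :: "('a,'b) pre_digraph \<Rightarrow> 'a set set" where
  "edges G = {{u, v} | u v. u \<rightarrow>\<^bsub>G\<^esub> v}"

definition independent :: "('a,'b) pre_digraph \<Rightarrow> 'a set \<Rightarrow> bool" where
  "independent G I \<longleftrightarrow> I \<subseteq> verts G \<and> (\<forall>u\<in>I. \<forall>v\<in>I. \<not> u \<rightarrow>\<^bsub>G\<^esub> v)"

definition maximum_independent :: "('a,'b) pre_digraph \<Rightarrow> 'a set \<Rightarrow> bool" where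
  "maximum_independent G I \<longleftrightarrow>
     independent G I \<and> (\<forall>J. independent G J \<longrightarrow> card J \<le> card I)"

definition alpha_excellent :: "('a,'b) pre_digraph \<Rightarrow> bool" where
  "alpha_excellent G \<longleftrightarrow> (\<forall>v\<in>verts G. \<exists>I. maximum_independent G I \<and> v \<in> I)"

definition support_vertex :: "('a,'b) pre_digraph \<Rightarrow> 'a \<Rightarrow> bool" where
  "support_vertex G u \<longleftrightarrow> u \<in> verts G \<and> (\<exists>v. u \<rightarrow>\<^bsub>G\<^esub> v \<and> out_degree G v = 1)"

definition pluck :: "('a,'b) pre_digraph \<Rightarrow> ('a,'b) pre_digraph \<Rightarrow> bool" where
  "pluck G H \<longleftrightarrow> 4 \<le> card (verts G) \<and>
     (\<exists>u v. support_vertex G u \<and> out_degree G u = 2 \<and>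
        {w. u \<rightarrow>\<^bsub>G\<^esub> w \<and> out_degree G w = 1} = {v} \<and>
        H = G \<restriction> (verts G - {u, v}))"

definition fully_plucked :: "('a,'b) pre_digraph \<Rightarrow> ('a,'b) pre_digraph \<Rightarrow> bool" where
  "fully_plucked G H \<longleftrightarrow> pluck\<^sup>*\<^sup>* G H \<and> \<not> (\<exists>K. pluck H K)"

lemma ex_fully_plucked:
  assumes "finite (verts G)"
  shows "\<exists>H. fully_plucked G H"
  using assms
proof (induction "card (verts G)" arbitrary: G rule: less_induct)
  case less
  show ?case
  proof (cases "\<exists>K. pluck G K")
    case False
    then show ?thesis by (auto simp: fully_plucked_def)
  next
    case True
    then obtain K where K: "pluck G K" by blast
    then obtain u v where "u \<in> verts G" "K = G \<restriction> (verts G - {u, v})"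
      unfolding pluck_def support_vertex_def by blast
    then have "verts K \<subset> verts G" by auto
    then have "card (verts K) < card (verts G)" "finite (verts K)"
      using less.prems by (auto intro: psubset_card_mono finite_subset)
    then obtain H where "fully_plucked K H" using less.hyps by blast
    then show ?thesis
      using K unfolding fully_plucked_def by (meson converse_rtranclp_into_rtranclp)
  qed
qed

text \<open>
  Some result exists by the lemma above, and the choice is only between the results of different
  plucking orders. A path on four vertices can be plucked to either of two edges, but in a connected
  graph containing a cycle any two distinct possible pluckings remove disjoint pairs of vertices and
  leave each other possible, so there the result does not depend on the order.
\<close>

definition plucked_graph :: "('a,'b) pre_digraph \<Rightarrow> ('a,'b) pre_digraph" where
  "plucked_graph G = (SOME H. fully_plucked G H)"

text \<open>
  In a symmetric digraph the closed walk \<open>u, v, u\<close> satisfies \<^const>\<open>pre_digraph.cycle\<close>, and every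
  undirected cycle is traversed by many closed walks. A cycle is therefore treated as a graph,
  traversed by a closed walk of length at least three, and cycles of a graph are counted as
  subgraphs.
\<close>

definition cycle_graph :: "('a,'b) pre_digraph \<Rightarrow> bool" where
  "cycle_graph C \<longleftrightarrow> graph C \<and>
     (\<exists>p. pre_digraph.cycle C p \<and> 3 \<le> length p \<and>
        verts C = tail C ` set p \<and>
        arcs_ends C = arc_to_ends C ` set p \<union> (arc_to_ends C ` set p)\<inverse>)"

definition cycle_of :: "('a,'b) pre_digraph \<Rightarrow> ('a,'b) pre_digraph \<Rightarrow> bool" where
  "cycle_of G C \<longleftrightarrow> subgraph C G \<and> cycle_graph C"

definition unicyclic :: "('a,'b) pre_digraph \<Rightarrow> bool" where
  "unicyclic G \<longleftrightarrow> (\<exists>!C. cycle_of G C)"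

definition girth :: "('a,'b) pre_digraph \<Rightarrow> nat" where
  "girth G = Inf {card (verts C) | C. cycle_of G C}"

definition caterpillar_wheel :: "('a,'b) pre_digraph \<Rightarrow> bool" where
  "caterpillar_wheel G \<longleftrightarrow> graph G \<and> connected G \<and> unicyclic G \<and> 3 \<le> girth G \<and>
     (\<forall>C. cycle_of G C \<longrightarrow> (\<forall>e\<in>edges G. e \<inter> verts C \<noteq> {}))"

definition legs :: "('a,'b) pre_digraph \<Rightarrow> 'a set set" where
  "legs G = {e \<in> edges G. \<exists>v\<in>e. out_degree G v = 1}"

definition perfect_matching :: "('a,'b) pre_digraph \<Rightarrow> 'a set set \<Rightarrow> bool" where
  "perfect_matching G M \<longleftrightarrow> M \<subseteq> edges G \<and> pairwise disjnt M \<and> \<Union>M = verts G"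

end

theory Submission
  imports Defs
begin

unbundle no funcset_syntax

text \<open>
  Plucking a support vertex \<open>u\<close> with its leaf \<open>v\<close> lowers the independence number by one and preserves
  connectedness, the cycles and \<open>\<alpha>\<close>-excellence in both directions, so \<open>G\<close> may be replaced by its
  plucked graph. If that graph is \<open>\<alpha>\<close>-excellent, every support vertex has a single leaf; a vertex off
  the cycle that is not a leaf would then produce a support vertex of degree two, so every vertex off
  the cycle is a leaf attached to the cycle.

  For such a graph, suppose that some support vertex exists. A maximum independent set containing a
  support vertex \<open>s\<close> must contain every second vertex of the segment of the cycle from \<open>s\<close> to the
  next support vertex, since otherwise a part of it could be shifted towards \<open>s\<close>, making room for
  one more vertex once \<open>s\<close> is traded for its leaf. Hence there is a second support vertex, and all
  segments between consecutive support vertices have an even number of vertices, which yields a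
  perfect matching. Conversely, given a perfect matching, an independent set meeting each of its edges
  is maximum, and such a set can be found through any vertex. To reach a support vertex \<open>s\<close>,
  start with \<open>s\<close>, take the far ends of the matching edges on the cycle up to another support vertex,
  from there on the near ends back to \<open>s\<close>, and complete with leaves.
\<close>

section \<open>Neighbours, connectedness and maximum independent sets\<close>

lemma dominates_induce_iff [simp]:
  "x \<rightarrow>\<^bsub>G \<restriction> S\<^esub> y \<longleftrightarrow> x \<rightarrow>\<^bsub>G\<^esub> y \<and> x \<in> S \<and> y \<in> S"
  by (auto simp: arcs_ends_conv)

lemma (in graph) graph_induce:
  assumes "S \<subseteq> verts G"
  shows "graph (G \<restriction> S)"
proof -
  have ind: "induced_subgraph (G \<restriction> S) G"
    using assms by (rule induced_induce)
  interpret H: digraph "G \<restriction> S"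
    by (rule digraphI_induced[OF ind])
  show ?thesis
    by (rule H.graphI) (use ind sym_arcs in \<open>blast intro: induced_graph_imp_symmetric\<close>)
qed

lemma (in nomulti_digraph) out_degree_eq_card_nbrs:
  "out_degree G v = card {w. v \<rightarrow> w}"
proof -
  have "bij_betw (head G) (out_arcs G v) {w. v \<rightarrow> w}"
    unfolding bij_betw_def
  proof
    show "inj_on (head G) (out_arcs G v)"
      by (rule inj_onI) (auto intro!: no_multi_arcs simp: arc_to_ends_def)
  qed (auto simp: arcs_ends_conv)
  then show ?thesis
    unfolding out_degree_def by (rule bij_betw_same_card)
qed

lemma (in nomulti_digraph) out_degree_eq_1_iff:
  "out_degree G v = 1 \<longleftrightarrow> (\<exists>w. \<forall>y. v \<rightarrow> y \<longleftrightarrow> y = w)"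
  unfolding out_degree_eq_card_nbrs card_1_singleton_iff One_nat_def by auto

text \<open>This and the converse \<open>connectedI_closed\<close> let connectedness be used and
  proved through sets closed under adjacency, without building walks.\<close>

lemma (in wf_digraph) connected_imp_closed_eq_verts:
  assumes "connected G" "symmetric G" "T \<subseteq> verts G" "T \<noteq> {}"
    and closed: "\<And>x y. x \<in> T \<Longrightarrow> x \<rightarrow> y \<Longrightarrow> y \<in> T"
  shows "T = verts G"
proof -
  have sc: "strongly_connected G"
    using assms by (intro symmetric_connected_imp_strongly_connected)
  obtain t where t: "t \<in> T" using assms by auto
  have "y \<in> T" if "t \<rightarrow>\<^sup>* y" for y
    using that by (induction rule: reachable_induct) (auto intro: t closed)
  then show ?thesis
    using sc t assms by (auto simp: strongly_connected_def)
qed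

lemma (in wf_digraph) connectedI_closed:
  assumes "verts G \<noteq> {}"
    and closed: "\<And>T. T \<subseteq> verts G \<Longrightarrow> T \<noteq> {} \<Longrightarrow> (\<And>x y. x \<in> T \<Longrightarrow> x \<rightarrow> y \<Longrightarrow> y \<in> T) \<Longrightarrow> T = verts G"
  shows "connected G"
proof (rule connectedI)
  fix u v assume uv: "u \<in> verts G" "v \<in> verts G"
  have "{y. u \<rightarrow>\<^sup>* y} = verts G"
    by (rule closed) (use uv in \<open>auto intro: reachable_in_verts reachable_adj_trans\<close>)
  then show "u \<rightarrow>\<^sup>*\<^bsub>mk_symmetric G\<^esub> v"
    using uv by (intro reachable_mk_symmetricI) auto
qed (fact assms)

section \<open>Independent sets of maximum size\<close>

lemma (in graph) independent_finite: "independent G I \<Longrightarrow> finite I"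
  unfolding independent_def by (auto intro: finite_subset[OF _ finite_verts])

lemma (in graph) maximum_independentI:
  assumes "maximum_independent G I" "independent G J" "card I \<le> card J"
  shows "maximum_independent G J"
  using assms unfolding maximum_independent_def by force

text \<open>A maximum set cannot grow when \<open>D\<close> is replaced by \<open>B\<close>; the
  condition on \<open>B \<inter> I\<close> keeps \<open>B\<close> disjoint from
  \<open>I - D\<close>, so that the sizes add up.\<close>

lemma (in graph) maximum_independent_exchange:
  assumes max: "maximum_independent G I" and D: "D \<subseteq> I" and B: "B \<inter> I \<subseteq> D"
    and ind: "independent G (I - D \<union> B)"
  shows "card B \<le> card D"
proof -
  have fin: "finite I" "finite B" "finite D"
    using max ind D independent_finite unfolding maximum_independent_def
    by (auto intro: finite_subset)
  have "card (I - D) + card B = card (I - D \<union> B)"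
    using fin B by (subst card_Un_disjoint) auto
  also have "\<dots> \<le> card I"
    using max ind by (simp add: maximum_independent_def)
  also have "\<dots> = card (I - D) + card D"
    using fin D by (simp add: card_Diff_subset card_mono)
  finally show ?thesis by simp
qed

lemma (in graph) ex_maximum_independent: "\<exists>I. maximum_independent G I"
proof -
  have "finite {I. independent G I}"
    by (rule finite_subset[of _ "Pow (verts G)"]) (auto simp: independent_def)
  moreover have "independent G {}" by (simp add: independent_def)
  ultimately have "Max (card ` {I. independent G I}) \<in> card ` {I. independent G I}"
    by (intro Max_in) auto
  then obtain I where I: "independent G I" "card I = Max (card ` {I. independent G I})"
    by auto
  have "card J \<le> card I" if "independent G J" for J
    unfolding I(2) using that \<open>finite _\<close> by (intro Max_ge) auto
  with I show ?thesis unfolding maximum_independent_def by blast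
qed

text \<open>Otherwise exchanging \<open>u\<close> for \<open>v\<close> and \<open>w\<close> would gain a vertex.\<close>

lemma (in graph) alpha_excellent_unique_leaf:
  assumes ex: "alpha_excellent G"
    and v: "\<And>y. v \<rightarrow> y \<longleftrightarrow> y = u" and w: "\<And>y. w \<rightarrow> y \<longleftrightarrow> y = u"
  shows "v = w"
proof (rule ccontr)
  assume "v \<noteq> w"
  have V: "u \<in> verts G" "v \<in> verts G" "w \<in> verts G"
    using v w adj_in_verts by blast+
  obtain I where I: "maximum_independent G I" "u \<in> I"
    using ex V unfolding alpha_excellent_def by blast
  then have ind: "independent G I" by (simp add: maximum_independent_def)
  have nuv: "u \<noteq> v" "u \<noteq> w" using v w adj_not_same by blast+
  have sym: "v \<rightarrow> x" if "x \<rightarrow> v" for x using graph_symmetric[OF that] .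
  have sym': "w \<rightarrow> x" if "x \<rightarrow> w" for x using graph_symmetric[OF that] .
  have "card {v, w} \<le> card {u}"
  proof (rule maximum_independent_exchange[OF I(1)])
    show "{v, w} \<inter> I \<subseteq> {u}"
      using ind I(2) v w unfolding independent_def by blast
    show "independent G (I - {u} \<union> {v, w})"
      using ind V nuv unfolding independent_def
      by (auto simp: v w dest: sym sym')
  qed (use I in auto)
  with \<open>v \<noteq> w\<close> show False by simp
qed

section \<open>Cycles\<close>

text \<open>A cycle has to be a symmetric subgraph, whereas \<open>p\<close> runs through its edges
  in one direction, so the arcs opposite to those of \<open>p\<close> are added.\<close>

lemma (in graph) cycle_imp_cycle_of:
  assumes p: "cycle p" and len: "3 \<le> length p"
  shows "\<exists>C. cycle_of G C \<and> verts C = tail G ` set p"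
proof -
  obtain u where u: "awalk u p u" "distinct (tl (awalk_verts u p))" and ne: "p \<noteq> []"
    using p unfolding cycle_def by blast
  define V where "V = tail G ` set p"
  define A where "A = {e \<in> arcs G. arc_to_ends G e \<in> arc_to_ends G ` set p \<union> (arc_to_ends G ` set p)\<inverse>}"
  define C where "C = \<lparr>verts = V, arcs = A, tail = tail G, head = head G\<rparr>"
  have pG: "set p \<subseteq> arcs G" using u by blast
  have uV: "u \<in> V" using u(1) ne unfolding V_def by (cases p) (auto simp: awalk_Cons_iff)
  \<comment> \<open>The head of an arc of \<open>p\<close> is the tail of the next one, or
    \<open>u\<close> for the last arc.\<close>
  have heads: "head G ` set p \<subseteq> V"
  proof -
    have "head G ` set p \<subseteq> insert u V"
      using set_awalk_verts_not_Nil[OF u(1) ne] u(1) ne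
      unfolding V_def awalk_verts_conv by (cases p rule: rev_cases) (auto simp: awalk_def)
    with uV show ?thesis by auto
  qed
  have comp: "compatible G C" by (simp add: compatible_def C_def)
  have wf: "wf_digraph C"
    by unfold_locales (use heads in \<open>auto simp: C_def A_def V_def arc_to_ends_def\<close>)
  have sub: "subgraph C G"
    by (rule subgraphI) (use wf comp pG wf_digraph in \<open>auto simp: C_def A_def V_def\<close>)
  interpret C: wf_digraph C by (rule wf)
  have ate: "arc_to_ends C = arc_to_ends G"
    by (simp add: C_def arc_to_ends_def fun_eq_iff)
  have ends: "arcs_ends C = arc_to_ends C ` set p \<union> (arc_to_ends C ` set p)\<inverse>"
  proof
    show "arcs_ends C \<subseteq> arc_to_ends C ` set p \<union> (arc_to_ends C ` set p)\<inverse>"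
      unfolding arcs_ends_def ate by (auto simp: C_def A_def)
    have fwd: "arc_to_ends G ` set p \<subseteq> arcs_ends C"
      using pG unfolding arcs_ends_def ate by (auto simp: C_def A_def)
    moreover have "(arc_to_ends G ` set p)\<inverse> \<subseteq> arcs_ends C"
    proof clarsimp
      fix x y e assume e: "(x, y) = arc_to_ends G e" "e \<in> set p"
      then have "x \<rightarrow> y" using pG unfolding arcs_ends_def by auto
      then have "y \<rightarrow> x" by (rule graph_symmetric)
      then obtain e' where "e' \<in> arcs G" "arc_to_ends G e' = (y, x)"
        by (auto simp: arc_to_ends_def)
      then show "(y, x) \<in> arcs_ends C"
        using e unfolding arcs_ends_def ate by (auto simp: C_def A_def intro!: image_eqI[of _ _ e'])
    qed
    ultimately show "arc_to_ends C ` set p \<union> (arc_to_ends C ` set p)\<inverse> \<subseteq> arcs_ends C"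
      unfolding ate by auto
  qed
  have "finite V" "finite A" unfolding V_def A_def by auto
  then interpret C: fin_digraph C by unfold_locales (auto simp: C_def)
  interpret C: digraph C
    by (rule digraph_subgraph) (fact sub)
  have "graph C"
    by (rule C.graphI) (auto simp: symmetric_def ends sym_def)
  moreover have "C.cycle p"
  proof -
    have "C.cas u p u" using u(1) compatible_cas[OF comp] by (simp add: awalk_def)
    moreover have "u \<in> verts C" using uV by (simp add: C_def)
    moreover have "set p \<subseteq> arcs C" using pG by (auto simp: C_def A_def)
    ultimately have "C.awalk u p u" unfolding C.awalk_def by blast
    then show ?thesis
      unfolding C.cycle_def using u(2) ne compatible_awalk_verts[OF comp] by auto
  qed
  ultimately have "cycle_graph C"
    unfolding cycle_graph_def using len ends by (auto simp: C_def V_def)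
  then show ?thesis
    using sub unfolding cycle_of_def by (auto simp: C_def V_def)
qed

text \<open>A path from \<open>a\<close> to \<open>b\<close> inside \<open>S\<close> is closed up
  through \<open>x\<close>. As \<open>a\<close> and \<open>b\<close> differ, the path has at least
  one arc, so the closed walk has length at least three.\<close>

lemma (in graph) cycle_through_two_nbrs:
  assumes S: "S \<subseteq> verts G" and ab: "a \<rightarrow>\<^sup>*\<^bsub>G \<restriction> S\<^esub> b" "a \<noteq> b"
    and x: "x \<notin> S" "x \<rightarrow> a" "x \<rightarrow> b"
  shows "\<exists>C. cycle_of G C \<and> x \<in> verts C \<and> verts C \<subseteq> insert x S"
proof -
  interpret S: wf_digraph "G \<restriction> S" by (rule wellformed_induce_subgraph)
  obtain p where p: "S.apath a p b" using ab(1) S.reachable_apath by blast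
  have sub: "subgraph (G \<restriction> S) G" using S by (rule subgraph_induce_subgraphI)
  have pG: "apath a p b" using p sub by (rule subgraph_apath_imp_apath)
  have vS: "set (awalk_verts a p) \<subseteq> S"
    using p unfolding S.apath_def S.awalk_conv awalk_verts_induce by auto
  obtain e1 where e1: "e1 \<in> arcs G" "tail G e1 = x" "head G e1 = a"
    using x(2) by (rule reachableE)
  obtain e2 where e2: "e2 \<in> arcs G" "tail G e2 = b" "head G e2 = x"
    using graph_symmetric[OF x(3)] by (rule reachableE)
  have ne: "p \<noteq> []" using pG ab(2) by (auto simp: apath_Nil_iff)
  have xG: "x \<in> verts G" using e1 by auto
  define q where "q = e1 # p @ [e2]"
  have ap: "awalk a p b" using pG by (simp add: apath_def)
  have ab': "awlast a p = b" using ap by (rule awlast_of_awalk) (simp add: NOMATCH_def)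
  have aw': "awalk a (p @ [e2]) x"
    using ap e2 xG ab' by (simp add: awalk_Cons_iff awalk_Nil_iff)
  then have aw: "awalk x q x"
    unfolding q_def awalk_Cons_iff using e1 by simp
  have "tl (awalk_verts x q) = awalk_verts a p @ [x]"
    using awalk_verts_append[OF aw'] e1 e2 by (simp add: q_def)
  moreover have "distinct (awalk_verts a p @ [x])"
    using pG vS x(1) unfolding apath_def by auto
  ultimately have "cycle q"
    unfolding cycle_def using aw by (auto simp: q_def)
  moreover have "3 \<le> length q" using ne by (cases p) (auto simp: q_def)
  ultimately obtain C where C: "cycle_of G C" "verts C = tail G ` set q"
    using cycle_imp_cycle_of by blast
  have "tail G ` set p \<subseteq> S" using vS awalk_verts_arc1 by blast
  moreover have "b \<in> S" using S.reachable_in_verts(2)[OF ab(1)] by simp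
  ultimately have "x \<in> verts C" "verts C \<subseteq> insert x S"
    unfolding C(2) q_def using e1(2) e2(2) by auto
  with C(1) show ?thesis by blast
qed

text \<open>The closed walk is read periodically: \<open>c i\<close> is the tail of its arc number
  \<open>i mod n\<close>.\<close>

lemma cycle_graph_enum:
  fixes C :: "('a, 'b) pre_digraph"
  assumes "cycle_graph C"
  obtains n :: int and c :: "int \<Rightarrow> 'a" where "3 \<le> n"
    "\<And>i j. c i = c j \<longleftrightarrow> i mod n = j mod n" "verts C = range c"
    "\<And>x y. x \<rightarrow>\<^bsub>C\<^esub> y \<longleftrightarrow> (\<exists>i. x = c i \<and> y = c (i + 1) \<or> y = c i \<and> x = c (i + 1))"
proof -
  obtain p where g: "graph C" and p: "pre_digraph.cycle C p" "3 \<le> length p"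
    "verts C = tail C ` set p"
    "arcs_ends C = arc_to_ends C ` set p \<union> (arc_to_ends C ` set p)\<inverse>"
    using assms unfolding cycle_graph_def by blast
  interpret graph C by (rule g)
  obtain u where u: "awalk u p u" "distinct (tl (awalk_verts u p))" and ne: "p \<noteq> []"
    using p(1) unfolding cycle_def by blast
  define k where "k = length p"
  define n where "n = int k"
  define c where "c i = tail C (p ! nat (i mod n))" for i
  have n: "3 \<le> n" using p(2) by (simp add: n_def k_def)
  have av: "awalk_verts u p = map (tail C) p @ [u]"
    using u(1) ne awlast_of_awalk[of u p u] by (auto simp: awalk_verts_conv)
  have hd: "tail C (p ! 0) = u"
    using u(1) ne by (cases p) (auto simp: awalk_Cons_iff)
  have dist: "distinct (map (tail C) p)"
    using u(2) hd ne unfolding av by (cases p) auto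
  have nat_lt: "nat (i mod n) < k" for i
    using n by (simp add: n_def nat_less_iff)
  have inj: "c i = c j \<longleftrightarrow> i mod n = j mod n" for i j
  proof
    assume "c i = c j"
    then have "map (tail C) p ! nat (i mod n) = map (tail C) p ! nat (j mod n)"
      using nat_lt unfolding c_def k_def by simp
    then have "nat (i mod n) = nat (j mod n)"
      using nth_eq_iff_index_eq[OF dist] nat_lt by (simp only: length_map k_def)
    then show "i mod n = j mod n" using n by (simp add: eq_nat_nat_iff)
  qed (simp add: c_def)
  have tail_c: "tail C (p ! m) = c (int m)" if "m < k" for m
    using that by (simp add: c_def n_def)
  have tail_p: "tail C ` set p = range c"
  proof
    show "tail C ` set p \<subseteq> range c"
      using tail_c by (auto simp: in_set_conv_nth k_def)
    show "range c \<subseteq> tail C ` set p"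
      using nat_lt by (auto simp: c_def k_def)
  qed
  \<comment> \<open>For the last arc the next index is \<open>n\<close>, where
    \<open>c n = c 0 = u\<close> closes the walk.\<close>
  have head_c: "head C (p ! m) = c (int m + 1)" if "m < k" for m
  proof -
    have "tl (awalk_verts u p) = map (head C) p"
      using u(1) ne awalk_verts_conv'[of u p u] by (auto simp: awalk_def)
    then have *: "map (head C) p ! m = (map (tail C) p @ [u]) ! Suc m"
      using that unfolding av k_def by (metis length_map nth_tl)
    show ?thesis
    proof (cases "Suc m < k")
      case True
      then show ?thesis using * tail_c[of "Suc m"] that by (simp add: nth_append k_def add.commute)
    next
      case False
      then have "Suc m = k" using that by simp
      then have "head C (p ! m) = u" "int m + 1 = n"
        using * that by (auto simp: nth_append k_def n_def)
      moreover have "c n = u" using hd by (simp add: c_def)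
      ultimately show ?thesis by simp
    qed
  qed
  have ends: "arc_to_ends C ` set p = {(c i, c (i + 1)) | i. True}"
  proof
    show "arc_to_ends C ` set p \<subseteq> {(c i, c (i + 1)) | i. True}"
      using tail_c head_c unfolding k_def by (fastforce simp: in_set_conv_nth arc_to_ends_def)
    show "{(c i, c (i + 1)) | i. True} \<subseteq> arc_to_ends C ` set p"
    proof clarify
      fix i
      have "p ! nat (i mod n) \<in> set p" using nat_lt by (simp add: k_def)
      moreover have "c (int (nat (i mod n))) = c i" "c (int (nat (i mod n)) + 1) = c (i + 1)"
        using n unfolding inj by (auto simp: mod_add_left_eq)
      ultimately show "(c i, c (i + 1)) \<in> arc_to_ends C ` set p"
        using tail_c[OF nat_lt[of i]] head_c[OF nat_lt[of i]]
        by (intro image_eqI[of _ _ "p ! nat (i mod n)"]) (auto simp: arc_to_ends_def)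
    qed
  qed
  show thesis
    by (rule that[of n c]) (use n inj tail_p p(3,4) in \<open>auto simp: ends\<close>)
qed

section \<open>Plucking\<close>

text \<open>The cycle neighbours \<open>c (i + 1)\<close> and \<open>c (i - 1)\<close> differ
  because \<open>n\<close> exceeds 2. Hence a vertex of degree one lies on no cycle.\<close>

lemma (in graph) cycle_of_two_nbrs:
  assumes C: "cycle_of G C" and x: "x \<in> verts C"
  obtains y z where "y \<in> verts C" "z \<in> verts C" "y \<noteq> z" "x \<rightarrow> y" "x \<rightarrow> z"
proof -
  have sub: "subgraph C G" and cg: "cycle_graph C"
    using C by (auto simp: cycle_of_def)
  obtain n :: int and c where c: "3 \<le> n" "\<And>i j. c i = c j \<longleftrightarrow> i mod n = j mod n"
    "verts C = range c"
    "\<And>x y. x \<rightarrow>\<^bsub>C\<^esub> y \<longleftrightarrow> (\<exists>i. x = c i \<and> y = c (i + 1) \<or> y = c i \<and> x = c (i + 1))"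
    by (rule cycle_graph_enum[OF cg]) (rule that)
  obtain i where i: "x = c i" using x c(3) by auto
  show thesis
  proof (rule that[of "c (i + 1)" "c (i - 1)"])
    show "c (i + 1) \<noteq> c (i - 1)"
    proof
      assume "c (i + 1) = c (i - 1)"
      then have "n dvd 2" unfolding c(2) by (simp add: mod_eq_dvd_iff)
      then show False using c(1) zdvd_imp_le[of n 2] by simp
    qed
    have "x \<rightarrow>\<^bsub>C\<^esub> c (i + 1)" "x \<rightarrow>\<^bsub>C\<^esub> c (i - 1)"
      unfolding c(4) i by (auto intro: exI[of _ "i - 1"])
    then show "x \<rightarrow> c (i + 1)" "x \<rightarrow> c (i - 1)"
      using sub by (auto intro: adj_mono)
  qed (use c(3) in auto)
qed

text \<open>\<open>u\<close> is the support vertex of degree two and \<open>v\<close> its leaf. The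
  neighbour \<open>z\<close> of \<open>w\<close> is recorded because an independent set through
  \<open>z\<close> avoids \<open>w\<close>, which leaves room for \<open>u\<close>.\<close>

locale plucking = graph +
  fixes u v w z
  assumes u_nbrs: "u \<rightarrow> y \<longleftrightarrow> y = v \<or> y = w" and v_nbrs: "v \<rightarrow> y \<longleftrightarrow> y = u"
    and w_nbr: "w \<rightarrow> z" and z_neq: "z \<noteq> u" and v_neq_w: "v \<noteq> w"
begin

abbreviation "H \<equiv> G \<restriction> (verts G - {u, v})"

lemma in_verts: "u \<in> verts G" "v \<in> verts G" "w \<in> verts G" "z \<in> verts G"
  using u_nbrs[of v] u_nbrs[of w] w_nbr by (auto dest: adj_in_verts)

lemma neqs: "u \<noteq> v" "u \<noteq> w" "z \<noteq> v" "v \<noteq> z" "u \<noteq> z"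
proof -
  show "u \<noteq> v" "u \<noteq> w" "u \<noteq> z" using u_nbrs[of u] adj_not_same[of u] z_neq by auto
  show "z \<noteq> v" using graph_symmetric[OF w_nbr] v_nbrs[of w] \<open>u \<noteq> w\<close> by auto
  then show "v \<noteq> z" by simp
qed

lemma nbrs_sym: "y \<rightarrow> u \<longleftrightarrow> y = v \<or> y = w" "y \<rightarrow> v \<longleftrightarrow> y = u"
  using u_nbrs v_nbrs graph_symmetric by metis+

lemma graph_H: "graph H"
  by (rule graph_induce) auto

lemma connected_H:
  assumes "connected G"
  shows "connected H"
proof -
  interpret H: graph H by (rule graph_H)
  show ?thesis
  proof (rule H.connectedI_closed)
    show "verts H \<noteq> {}" using in_verts v_neq_w neqs by auto
  next
    fix T assume T: "T \<subseteq> verts H" "T \<noteq> {}" and cl: "\<And>x y. x \<in> T \<Longrightarrow> x \<rightarrow>\<^bsub>H\<^esub> y \<Longrightarrow> y \<in> T"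
    have closed: "y \<in> T" if "x \<in> T" "x \<rightarrow> y" "y \<notin> {u, v}" for x y
      by (rule cl[of x]) (use that T adj_in_verts[OF that(2)] in auto)
    \<comment> \<open>A set closed in \<open>H\<close> is closed in \<open>G\<close> as well, after
      adding \<open>u\<close> and \<open>v\<close> in case it contains \<open>w\<close>, the only
      vertex of \<open>H\<close> adjacent to a removed one.\<close>
    show "T = verts H"
    proof (cases "w \<in> T")
      case True
      have "T \<union> {u, v} = verts G"
        by (rule connected_imp_closed_eq_verts[OF assms sym_arcs])
          (use T in_verts closed True in \<open>auto simp: u_nbrs v_nbrs\<close>)
      then show ?thesis using T by auto
    next
      case False
      have "T = verts G"
      proof (rule connected_imp_closed_eq_verts[OF assms sym_arcs])
        fix x y assume xy: "x \<in> T" "x \<rightarrow> y"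
        then have "x \<noteq> u" "x \<noteq> v" "x \<noteq> w" using T False by auto
        then have "y \<notin> {u, v}" using xy(2) nbrs_sym by blast
        with xy show "y \<in> T" by (rule closed)
      qed (use T in auto)
      then show ?thesis using T in_verts by auto
    qed
  qed
qed

lemma cycle_of_H_iff: "cycle_of H C \<longleftrightarrow> cycle_of G C"
proof
  assume "cycle_of H C"
  then show "cycle_of G C"
    using subgraph_induce_subgraphI[of "verts G - {u, v}"]
    unfolding cycle_of_def by (auto intro: subgraph_trans)
next
  assume C: "cycle_of G C"
  \<comment> \<open>A vertex of a cycle has two neighbours on it. This excludes \<open>v\<close>,
    and then \<open>u\<close>, for which only \<open>w\<close> is left.\<close>
  have v: "v \<notin> verts C"
    by (metis C cycle_of_two_nbrs v_nbrs)
  moreover have u: "u \<notin> verts C"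
    by (metis C cycle_of_two_nbrs u_nbrs v)
  moreover have sub: "subgraph C G" using C by (simp add: cycle_of_def)
  ultimately have VC: "verts C \<subseteq> verts G - {u, v}" by auto
  have "subgraph C H"
  proof (rule subgraphI)
    have sc: "wf_digraph C" "arcs C \<subseteq> arcs G" "tail G = tail C" "head G = head C"
      using sub by (auto simp: compatible_def)
    then have "tail G e \<in> verts C" "head G e \<in> verts C" if "e \<in> arcs C" for e
      using that by (auto simp: wf_digraph.wellformed)
    then show "arcs C \<subseteq> arcs H"
      using sc VC by auto
    show "compatible H C" using sc by (simp add: compatible_def)
  qed (use VC sub in auto)
  then show "cycle_of H C" using C by (simp add: cycle_of_def)
qed

lemma independent_H_iff: "independent H I \<longleftrightarrow> independent G I \<and> u \<notin> I \<and> v \<notin> I"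
  unfolding independent_def by auto

lemma independent_insert_v: "independent H I \<Longrightarrow> independent G (insert v I)"
  unfolding independent_H_iff using in_verts neqs
  by (auto simp: independent_def v_nbrs nbrs_sym)

lemma independent_insert_u: "independent H I \<Longrightarrow> w \<notin> I \<Longrightarrow> independent G (insert u I)"
  unfolding independent_H_iff using in_verts neqs
  by (auto simp: independent_def u_nbrs nbrs_sym)

lemma independent_remove:
  assumes "independent G I"
  shows "independent H (I - {u, v})" "card I \<le> Suc (card (I - {u, v}))"
proof -
  show "independent H (I - {u, v})"
    using assms unfolding independent_H_iff by (auto simp: independent_def)
  have "finite I" using assms by (rule independent_finite)
  have "\<not> (u \<in> I \<and> v \<in> I)"
    using assms v_nbrs unfolding independent_def by blast
  then have "\<exists>a. I \<inter> {u, v} \<subseteq> {a}" by auto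
  then have "card (I \<inter> {u, v}) \<le> 1"
    using card_mono[of "{_}" "I \<inter> {u, v}"] by auto
  moreover have "card I = card (I - {u, v}) + card (I \<inter> {u, v})"
    using \<open>finite I\<close> card_Int_Diff[of I "{u, v}"] by simp
  ultimately show "card I \<le> Suc (card (I - {u, v}))" by simp
qed

text \<open>Together with \<open>maximum_independent_restrict\<close> this expresses that plucking
  lowers the independence number by exactly one: an independent set of \<open>G\<close> loses at
  most one vertex, while \<open>v\<close> can always be added.\<close>

lemma maximum_independent_extend:
  assumes I: "maximum_independent H I" and a: "independent G (insert a I)" "a \<in> {u, v}"
  shows "maximum_independent G (insert a I)"
  unfolding maximum_independent_def
proof (intro conjI allI impI)
  fix J assume J: "independent G J"
  have fin: "finite I"
    using independent_finite[OF a(1)] by simp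
  have "card J \<le> Suc (card (J - {u, v}))" using independent_remove(2)[OF J] .
  also have "\<dots> \<le> Suc (card I)"
    using I independent_remove(1)[OF J] unfolding maximum_independent_def by simp
  also have "\<dots> = card (insert a I)"
    using fin a(2) I unfolding maximum_independent_def independent_H_iff by auto
  finally show "card J \<le> card (insert a I)" .
qed (fact a(1))

lemma maximum_independent_restrict:
  assumes I: "maximum_independent G I"
  shows "maximum_independent H (I - {u, v})"
  unfolding maximum_independent_def
proof (intro conjI allI impI)
  have ind: "independent G I" using I by (simp add: maximum_independent_def)
  then show "independent H (I - {u, v})" by (rule independent_remove)
  fix J assume J: "independent H J"
  then have "finite J" "v \<notin> J"
    using independent_finite independent_H_iff by auto
  then have "Suc (card J) = card (insert v J)" by simp
  also have "\<dots> \<le> card I"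
    using I independent_insert_v[OF J] unfolding maximum_independent_def by blast
  also have "\<dots> \<le> Suc (card (I - {u, v}))" using ind by (rule independent_remove)
  finally show "card J \<le> card (I - {u, v})" by simp
qed

text \<open>Going up, \<open>v\<close> extends every maximum independent set of \<open>H\<close>,
  and \<open>u\<close> extends one through \<open>z\<close>, since that set avoids \<open>w\<close>.
  Going down, \<open>u\<close> and \<open>v\<close> are deleted.\<close>

lemma alpha_excellent_H_iff: "alpha_excellent H \<longleftrightarrow> alpha_excellent G"
proof
  assume H: "alpha_excellent H"
  interpret H: graph H by (rule graph_H)
  have "z \<in> verts H" using in_verts neqs by auto
  then obtain I where I: "maximum_independent H I" "z \<in> I"
    using H unfolding alpha_excellent_def by blast
  have indI: "independent H I" using I by (simp add: maximum_independent_def)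
  have "w \<notin> I"
    using indI I(2) w_nbr graph_symmetric[OF w_nbr] unfolding independent_H_iff
    by (auto simp: independent_def)
  then have u: "maximum_independent G (insert u I)"
    using I indI independent_insert_u by (intro maximum_independent_extend) auto
  have ext: "maximum_independent G (insert v J)" if "maximum_independent H J" for J
    using that independent_insert_v
    by (intro maximum_independent_extend) (auto simp: maximum_independent_def)
  show "alpha_excellent G"
    unfolding alpha_excellent_def
  proof
    fix x assume "x \<in> verts G"
    then consider "x = u" | "x = v" | "x \<in> verts H" by auto
    then show "\<exists>J. maximum_independent G J \<and> x \<in> J"
    proof cases
      case 3
      then show ?thesis using H ext unfolding alpha_excellent_def by blast
    qed (use u ext[OF I(1)] in blast)+
  qed
next
  assume G: "alpha_excellent G"
  show "alpha_excellent H"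
    unfolding alpha_excellent_def
  proof
    fix x assume "x \<in> verts H"
    moreover then obtain I where "maximum_independent G I" "x \<in> I"
      using G unfolding alpha_excellent_def by auto
    ultimately show "\<exists>J. maximum_independent H J \<and> x \<in> J"
      using maximum_independent_restrict by auto
  qed
qed

end

lemma (in graph) pluck_imp_plucking:
  assumes "pluck G K"
  obtains u v w z where "plucking G u v w z" "K = G \<restriction> (verts G - {u, v})"
proof -
  obtain u v where deg: "out_degree G u = 2"
    and leaf: "{w. u \<rightarrow> w \<and> out_degree G w = 1} = {v}" and K: "K = G \<restriction> (verts G - {u, v})"
    using assms unfolding pluck_def by blast
  have uv: "u \<rightarrow> v" and v1: "out_degree G v = 1" using leaf by auto
  have v: "v \<rightarrow> y \<longleftrightarrow> y = u" for y
    using v1 graph_symmetric[OF uv] unfolding out_degree_eq_1_iff by metis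
  obtain a b where "a \<noteq> b" "{y. u \<rightarrow> y} = {a, b}"
    using deg unfolding out_degree_eq_card_nbrs by (auto simp: card_2_iff)
  with uv obtain w where w: "v \<noteq> w" "{y. u \<rightarrow> y} = {v, w}"
    by (metis doubleton_eq_iff insert_iff mem_Collect_eq singletonD)
  then have u: "u \<rightarrow> y \<longleftrightarrow> y = v \<or> y = w" for y by auto
  \<comment> \<open>As \<open>v\<close> is the only leaf at \<open>u\<close>, the other neighbour
    \<open>w\<close> is no leaf and so has a neighbour \<open>z\<close> besides
    \<open>u\<close>.\<close>
  have "out_degree G w \<noteq> 1"
  proof
    assume "out_degree G w = 1"
    with u have "w \<in> {w. u \<rightarrow> w \<and> out_degree G w = 1}" by simp
    with leaf w(1) show False by simp
  qed
  moreover have "w \<rightarrow> u" using u graph_symmetric by blast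
  ultimately obtain z where "w \<rightarrow> z" "z \<noteq> u"
    unfolding out_degree_eq_1_iff by metis
  then have "plucking G u v w z"
    by unfold_locales (use u v w in auto)
  then show thesis using that K by blast
qed

lemma rtranclp_pluck_invariant:
  assumes "pluck\<^sup>*\<^sup>* G H" "graph G" "connected G"
  shows "graph H \<and> connected H \<and> (\<forall>C. cycle_of H C \<longleftrightarrow> cycle_of G C) \<and>
    (alpha_excellent H \<longleftrightarrow> alpha_excellent G)"
  using assms(1)
proof induction
  case (step H K)
  then interpret H: graph H by simp
  obtain u v w z where "plucking H u v w z" and K: "K = H \<restriction> (verts H - {u, v})"
    using H.pluck_imp_plucking[OF step.hyps(2)] .
  then interpret plucking H u v w z by simp
  show ?case
    using step.IH graph_H connected_H cycle_of_H_iff alpha_excellent_H_iff unfolding K by simp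
qed (use assms(2,3) in simp)

section \<open>Cycles with pendant vertices\<close>

lemma (in graph) perfect_matching_unique:
  assumes "perfect_matching G M" "e \<in> M" "f \<in> M" "x \<in> e" "x \<in> f"
  shows "e = f"
  using assms unfolding perfect_matching_def pairwise_def disjnt_def by blast

lemma (in graph) perfect_matching_edge:
  assumes "perfect_matching G M" "e \<in> M"
  obtains x y where "e = {x, y}" "x \<rightarrow> y"
  using assms unfolding perfect_matching_def edges_def by blast

lemma (in graph) perfect_matching_cover:
  assumes "perfect_matching G M" "x \<in> verts G"
  obtains y where "{x, y} \<in> M" "x \<rightarrow> y"
proof -
  obtain e where e: "e \<in> M" "x \<in> e"
    using assms unfolding perfect_matching_def by blast
  obtain a b where ab: "e = {a, b}" "a \<rightarrow> b"
    using perfect_matching_edge[OF assms(1) e(1)] .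
  then have "x = a \<or> x = b" using e(2) by simp
  then show thesis
  proof
    assume "x = b"
    then show thesis using that[of a] e ab graph_symmetric[OF ab(2)] by (simp add: insert_commute)
  qed (use that e ab in blast)
qed

text \<open>An independent set contains at most one end of each edge of \<open>M\<close>.\<close>

lemma (in graph) maximum_independent_if_meets_perfect_matching:
  assumes pm: "perfect_matching G M" and I: "independent G I"
    and meets: "\<And>e. e \<in> M \<Longrightarrow> I \<inter> e \<noteq> {}"
  shows "maximum_independent G I"
  unfolding maximum_independent_def
proof (intro conjI allI impI)
  fix J assume J: "independent G J"
  have "\<forall>x\<in>J. \<exists>e\<in>M. x \<in> e"
    using J pm unfolding independent_def perfect_matching_def by blast
  then obtain f where f: "\<And>x. x \<in> J \<Longrightarrow> f x \<in> M \<and> x \<in> f x" by metis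
  have "\<forall>e\<in>M. \<exists>x\<in>I. x \<in> e" using meets by blast
  then obtain g where g: "\<And>e. e \<in> M \<Longrightarrow> g e \<in> I \<and> g e \<in> e" by metis
  \<comment> \<open>Here \<open>f\<close> picks the matching edge of a vertex of \<open>J\<close>
    and \<open>g\<close> a vertex of \<open>I\<close> on that edge, so \<open>J\<close> injects into
    \<open>I\<close>.\<close>
  have "inj_on (g \<circ> f) J"
  proof (rule inj_onI)
    fix x y assume xy: "x \<in> J" "y \<in> J" "(g \<circ> f) x = (g \<circ> f) y"
    have fx: "f x \<in> M" "x \<in> f x" and fy: "f y \<in> M" "y \<in> f y"
      using f xy by blast+
    have "f x = f y"
      by (rule perfect_matching_unique[OF pm, of _ _ "g (f x)"])
        (use fx fy g[of "f x"] g[of "f y"] xy(3) in auto)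
    obtain a b where ab: "f x = {a, b}" "a \<rightarrow> b"
      using perfect_matching_edge[OF pm fx(1)] .
    then have "\<not> (a \<in> J \<and> b \<in> J)" using J unfolding independent_def by blast
    then show "x = y" using fx fy ab xy \<open>f x = f y\<close> by auto
  qed
  moreover have "(g \<circ> f) ` J \<subseteq> I" using f g by auto
  ultimately show "card J \<le> card I"
    using independent_finite[OF I] by (rule card_inj_on_le)
qed (fact I)

text \<open>
  The cycle is enumerated periodically by the integers, so that indices never wrap around; every
  vertex off the cycle is a leaf.
\<close>

locale sun = graph +
  fixes n :: int and c :: "int \<Rightarrow> 'a"
  assumes n_ge_3: "3 \<le> n"
    and c_eq_iff: "c i = c j \<longleftrightarrow> i mod n = j mod n"
    and c_adj: "c i \<rightarrow> c (i + 1)"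
    and chordless: "c i \<rightarrow> c j \<Longrightarrow> c j = c (i + 1) \<or> c j = c (i - 1)"
    and pendant: "x \<in> verts G \<Longrightarrow> x \<notin> range c \<Longrightarrow> \<exists>i. \<forall>y. x \<rightarrow> y \<longleftrightarrow> y = c i"
begin

text \<open>Vertices off the cycle being leaves, this marks the support vertices, as a periodic
  predicate on indices.\<close>

definition supp :: "int \<Rightarrow> bool" where
  "supp i \<longleftrightarrow> (\<exists>x. x \<notin> range c \<and> x \<rightarrow> c i)"

section \<open>Indices and adjacency on the cycle\<close>

lemma c_in_verts: "c i \<in> verts G"
  using c_adj adj_in_verts by blast

lemma c_adj': "c i \<rightarrow> c (i - 1)" "c (i + 1) \<rightarrow> c i"
  using c_adj[of "i - 1"] c_adj[of i] graph_symmetric by auto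

lemma c_eq_iff_window: "\<bar>i - j\<bar> < n \<Longrightarrow> c i = c j \<longleftrightarrow> i = j"
  unfolding c_eq_iff using dvd_imp_le_int[of "i - j" n] n_ge_3
  by (auto simp: mod_eq_dvd_iff)

lemma c_shift: "c i = c j \<Longrightarrow> c (i + k) = c (j + k)"
  unfolding c_eq_iff by (metis mod_add_left_eq)

lemma c_shift_minus: "c i = c j \<Longrightarrow> c (i - k) = c (j - k)"
  using c_shift[of i j "- k"] by simp

lemma c_add_n: "c (i + n) = c i"
  unfolding c_eq_iff by simp

lemma c_window: obtains j where "s \<le> j" "j < s + n" "c j = c i"
proof
  show "s \<le> s + (i - s) mod n" "s + (i - s) mod n < s + n" using n_ge_3 by auto
  show "c (s + (i - s) mod n) = c i" unfolding c_eq_iff by (simp add: mod_add_right_eq)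
qed

lemma c_neq: "c (i + 1) \<noteq> c i" "c (i - 1) \<noteq> c i" "c (i + 1) \<noteq> c (i - 1)"
  using n_ge_3 by (simp_all add: c_eq_iff_window)

lemma supp_cong: "c i = c j \<Longrightarrow> supp i \<longleftrightarrow> supp j"
  unfolding supp_def by simp

lemma pendant_nbrs:
  assumes "x \<notin> range c" "x \<rightarrow> c i"
  shows "x \<rightarrow> y \<longleftrightarrow> y = c i" "y \<rightarrow> x \<longleftrightarrow> y = c i"
proof -
  obtain j where j: "\<And>y. x \<rightarrow> y \<longleftrightarrow> y = c j"
    using pendant[of x] assms adj_in_verts by blast
  with assms(2) have "c i = c j" by blast
  with j show "x \<rightarrow> y \<longleftrightarrow> y = c i" by simp
  then show "y \<rightarrow> x \<longleftrightarrow> y = c i" using graph_symmetric by metis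
qed

lemma nbrs_cycle:
  assumes "c i \<rightarrow> y" "\<not> supp i"
  shows "y = c (i + 1) \<or> y = c (i - 1)"
proof -
  have "y \<in> range c" using assms graph_symmetric unfolding supp_def by blast
  then show ?thesis using assms(1) chordless by blast
qed

lemma adj_cases:
  assumes "x \<rightarrow> y"
  obtains (out) i where "x \<notin> range c" "y = c i" | (inw) i where "y \<notin> range c" "x = c i"
    | (fwd) i where "x = c i" "y = c (i + 1)" | (bwd) i where "y = c i" "x = c (i + 1)"
proof (cases "x \<in> range c \<and> y \<in> range c")
  case True
  then obtain i j where ij: "x = c i" "y = c j" by blast
  with assms have "c j = c (i + 1) \<or> c j = c (i - 1)" using chordless by blast
  then show thesis using ij fwd[of i] bwd[of "i - 1"] by auto
next
  case False
  have out': thesis if "x \<notin> range c"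
    using pendant[of x] that assms adj_in_verts out by blast
  have "y \<rightarrow> x" using assms by (rule graph_symmetric)
  then have thesis if "y \<notin> range c"
    using pendant[of y] that adj_in_verts inw by blast
  with out' False show thesis by blast
qed

lemma out_degree_eq_1_iff_pendant:
  assumes "x \<in> verts G"
  shows "out_degree G x = 1 \<longleftrightarrow> x \<notin> range c"
proof
  assume "out_degree G x = 1"
  then show "x \<notin> range c"
    unfolding out_degree_eq_1_iff using c_adj c_adj' c_neq(3) by (metis rangeE)
next
  assume "x \<notin> range c"
  then show "out_degree G x = 1"
    using pendant[OF assms] unfolding out_degree_eq_1_iff by blast
qed

lemma legs_eq: "legs G = {{x, c i} | x i. x \<notin> range c \<and> x \<rightarrow> c i}"
proof
  show "legs G \<subseteq> {{x, c i} | x i. x \<notin> range c \<and> x \<rightarrow> c i}"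
  proof
    fix e assume "e \<in> legs G"
    then obtain x y v where e: "e = {x, y}" "x \<rightarrow> y" "v \<in> e" "out_degree G v = 1"
      unfolding legs_def edges_def by blast
    then have "v \<in> verts G" using adj_in_verts by blast
    with e have "x \<notin> range c \<or> y \<notin> range c"
      using out_degree_eq_1_iff_pendant by auto
    with e(2) have "\<exists>a i. {x, y} = {a, c i} \<and> a \<notin> range c \<and> a \<rightarrow> c i"
    proof (cases rule: adj_cases)
      case (out i)
      with e(2) show ?thesis by blast
    next
      case (inw i)
      with graph_symmetric[OF e(2)] show ?thesis by blast
    qed auto
    then show "e \<in> {{x, c i} | x i. x \<notin> range c \<and> x \<rightarrow> c i}" using e(1) by blast
  qed
  show "{{x, c i} | x i. x \<notin> range c \<and> x \<rightarrow> c i} \<subseteq> legs G"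
  proof clarify
    fix x i assume x: "x \<notin> range c" "x \<rightarrow> c i"
    then have "out_degree G x = 1"
      using adj_in_verts out_degree_eq_1_iff_pendant by blast
    with x(2) show "{x, c i} \<in> legs G" unfolding legs_def edges_def by blast
  qed
qed

section \<open>From a perfect matching to excellence\<close>

lemma pendant_matched:
  assumes pm: "perfect_matching G M" and x: "x \<notin> range c" "x \<rightarrow> c i"
  shows "{x, c i} \<in> M"
  using perfect_matching_cover[OF pm adj_in_verts(1)[OF x(2)]] pendant_nbrs[OF x] by metis

lemma matched_unique:
  assumes "perfect_matching G M" "{x, y} \<in> M" "{x, z} \<in> M"
  shows "y = z"
  using perfect_matching_unique[OF assms, of x] by (auto simp: doubleton_eq_iff)

lemma matched_unique':
  assumes "perfect_matching G M" "{y, x} \<in> M" "{x, z} \<in> M"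
  shows "y = z"
  using matched_unique[OF assms(1), of x y z] assms by (simp add: insert_commute)

text \<open>A support vertex is already matched with its leaf.\<close>

lemma supp_not_matched_on_cycle:
  assumes pm: "perfect_matching G M" and "supp i"
  shows "{c i, c (i + 1)} \<notin> M" "{c (i - 1), c i} \<notin> M"
proof -
  obtain x where x: "x \<notin> range c" "{x, c i} \<in> M"
    using assms pendant_matched unfolding supp_def by blast
  then show "{c i, c (i + 1)} \<notin> M" using matched_unique'[OF pm x(2)] by blast
  show "{c (i - 1), c i} \<notin> M"
    using x matched_unique[OF pm, of "c i" x "c (i - 1)"] by (auto simp: insert_commute)
qed

text \<open>The set is prescribed by its trace \<open>Q\<close> on the cycle and completed by all
  leaves not attached to \<open>Q\<close>. Each leg is then met at one of its ends, so only matching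
  edges on the cycle have to be checked.\<close>

lemma maximum_independent_sun:
  assumes pm: "perfect_matching G M" and Q: "Q \<subseteq> range c"
    and no_consecutive: "\<And>i. c i \<in> Q \<Longrightarrow> c (i + 1) \<in> Q \<Longrightarrow> False"
    and meets: "\<And>i. {c i, c (i + 1)} \<in> M \<Longrightarrow> c i \<in> Q \<or> c (i + 1) \<in> Q"
  shows "maximum_independent G (Q \<union> {x \<in> verts G - range c. \<forall>y\<in>Q. \<not> x \<rightarrow> y})"
    (is "maximum_independent G ?I")
proof (rule maximum_independent_if_meets_perfect_matching[OF pm])
  have "\<not> x \<rightarrow> y" if "x \<in> ?I" "y \<in> ?I" for x y
  proof
    assume "x \<rightarrow> y"
    then show False
    proof (cases rule: adj_cases)
      case (out i)
      then show False using that \<open>x \<rightarrow> y\<close> Q by auto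
    next
      case (inw i)
      then show False using that graph_symmetric[OF \<open>x \<rightarrow> y\<close>] Q by auto
    qed (use that no_consecutive in auto)
  qed
  then show "independent G ?I"
    using Q c_in_verts unfolding independent_def by auto
next
  fix e assume eM: "e \<in> M"
  then obtain x y where e: "e = {x, y}" "x \<rightarrow> y"
    using perfect_matching_edge[OF pm] by blast
  have pend: "{a, c i} \<inter> ?I \<noteq> {}" if "a \<notin> range c" "a \<rightarrow> c i" for a i
    using that adj_in_verts(1)[OF that(2)] pendant_nbrs(1)[OF that] by auto
  from e(2) show "?I \<inter> e \<noteq> {}"
  proof (cases rule: adj_cases)
    case (out i)
    then show ?thesis using pend[of x i] e by auto
  next
    case (inw i)
    then show ?thesis using pend[of y i] graph_symmetric[OF e(2)] e by auto
  next
    case (fwd i)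
    then show ?thesis using meets[of i] eM e by auto
  next
    case (bwd i)
    then show ?thesis using meets[of i] eM e by (auto simp: insert_commute)
  qed
qed

lemma ex_maximum_independent_supp:
  assumes pm: "perfect_matching G M" and s: "supp s" and t: "supp t" "c t \<noteq> c s"
  shows "\<exists>I. maximum_independent G I \<and> c s \<in> I"
proof -
  obtain p where p: "s \<le> p" "p < s + n" "c p = c t" using c_window[of s t] .
  have "p \<noteq> s" using p t by auto
  with p(1) have sp: "s < p" by simp
  have sup_p: "supp p" using p t supp_cong by blast
  \<comment> \<open>In the window \<open>s, ..., s + n - 1\<close>, the set \<open>W\<close>
    consists of \<open>s\<close>, the later ends of the matching edges between \<open>s\<close> and
    \<open>p\<close>, and the earlier ends of those beyond \<open>p\<close>; the index
    \<open>p\<close> itself is left out.\<close>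
  define W where "W = {j. s \<le> j \<and> j < s + n \<and>
    (j = s \<or> s < j \<and> j < p \<and> {c (j - 1), c j} \<in> M \<or> p < j \<and> {c j, c (j + 1)} \<in> M)}"
  define Q where "Q = c ` W"
  \<comment> \<open>Within a window of length \<open>n\<close> the map \<open>c\<close> is
    injective, so membership in \<open>Q\<close> can be tested on indices.\<close>
  have in_Q: "c j \<in> Q \<longleftrightarrow> j \<in> W" if "s \<le> j" "j < s + n" for j
  proof
    assume "c j \<in> Q"
    then obtain k where k: "k \<in> W" "c j = c k" unfolding Q_def by blast
    then have "j = k" using that c_eq_iff_window[of j k] by (auto simp: W_def)
    then show "j \<in> W" using k by simp
  qed (simp add: Q_def)
  have ss: "c (s + n) = c s" by (rule c_add_n)
  have not_s: "{c s, c (s + 1)} \<notin> M" "{c (s + n - 1), c s} \<notin> M"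
    and not_p: "{c p, c (p + 1)} \<notin> M" "{c (p - 1), c p} \<notin> M"
    using supp_not_matched_on_cycle[OF pm s] supp_not_matched_on_cycle[OF pm sup_p]
      c_shift[OF ss, of "-1"] by auto
  have two: "False" if "{c (j - 1), c j} \<in> M" "{c j, c (j + 1)} \<in> M" for j
    using matched_unique'[OF pm that] c_neq(3)[of j] by auto
  have "maximum_independent G (Q \<union> {x \<in> verts G - range c. \<forall>y\<in>Q. \<not> x \<rightarrow> y})"
  proof (rule maximum_independent_sun[OF pm])
    show "Q \<subseteq> range c" unfolding Q_def by auto
  next
    fix i assume i: "c i \<in> Q" "c (i + 1) \<in> Q"
    obtain j where j: "s \<le> j" "j < s + n" "c j = c i" using c_window[of s i] .
    then have cj: "c j \<in> Q" "c (j + 1) \<in> Q" using i c_shift[OF j(3), of 1] by auto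
    then have jW: "j \<in> W" using in_Q j by blast
    show False
    \<comment> \<open>At the end of the window, \<open>j + 1\<close> stands for \<open>s\<close>
      again. There \<open>j\<close> can only be an earlier end beyond \<open>p\<close>, which would
      match \<open>c j\<close> with the support vertex \<open>c s\<close>.\<close>
    proof (cases "j + 1 = s + n")
      case True
      then have "p < j" "{c j, c (j + 1)} \<in> M" 
        using jW p sp not_s n_ge_3 by (auto simp: W_def)
      moreover have "j = s + n - 1" using True by simp
      ultimately show False using ss not_s(2) by simp
    next
      case False
      then have "j + 1 \<in> W" using cj(2) in_Q[of "j + 1"] j by simp
      \<comment> \<open>Two adjacent indices of \<open>W\<close> on the same side of
        \<open>p\<close> would put a vertex on two matching edges or match \<open>c s\<close> along
        the cycle; since \<open>p\<close> is left out, they cannot lie on different sides.\<close>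
      then show False using jW two[of j] two[of "j + 1"] not_s not_p sp
        by (auto simp: W_def)
    qed
  next
    fix i assume i: "{c i, c (i + 1)} \<in> M"
    obtain j where j: "s \<le> j" "j < s + n" "c j = c i" using c_window[of s i] .
    have cji: "c (j + 1) = c (i + 1)" using c_shift[OF j(3)] .
    have jM: "{c j, c (j + 1)} \<in> M" using i j cji by simp
    \<comment> \<open>No matching edge on the cycle contains \<open>c p\<close>, so its two indices
      lie on the same side of \<open>p\<close>, where \<open>W\<close> has one of them.\<close>
    have "j \<noteq> s" "j \<noteq> p" "j + 1 \<noteq> p" using jM not_s not_p by auto
    then have "j \<in> W \<or> j + 1 \<in> W"
      using j jM p by (auto simp: W_def)
    then show "c i \<in> Q \<or> c (i + 1) \<in> Q" using j(3) cji unfolding Q_def by (metis imageI)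
  qed
  moreover have "s \<in> W" using n_ge_3 by (simp add: W_def)
  ultimately show ?thesis unfolding Q_def by blast
qed

text \<open>\<open>L\<close> and \<open>R\<close> collect the earlier and the later ends of the
  matching edges on the cycle. Every leaf can be added to \<open>L\<close>, and a cycle vertex
  without a leaf lies in \<open>L\<close> or \<open>R\<close>. For a support vertex,
  \<open>s\<close> or \<open>t\<close> serves as the second one in
  \<open>ex_maximum_independent_supp\<close>.\<close>

lemma alpha_excellent_if_perfect_matching:
  assumes pm: "perfect_matching G M" and st: "supp s" "supp t" "c s \<noteq> c t"
  shows "alpha_excellent G"
proof -
  have two: "False" if "{c (j - 1), c j} \<in> M" "{c j, c (j + 1)} \<in> M" for j
    using matched_unique'[OF pm that] c_neq(3)[of j] by auto
  define L where "L = {c j | j. {c j, c (j + 1)} \<in> M}"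
  define R where "R = {c j | j. {c (j - 1), c j} \<in> M}"
  have L: "c j \<in> L \<longleftrightarrow> {c j, c (j + 1)} \<in> M" for j
  proof
    assume "c j \<in> L"
    then obtain k where "c j = c k" "{c k, c (k + 1)} \<in> M" unfolding L_def by blast
    then show "{c j, c (j + 1)} \<in> M" using c_shift[of j k 1] by simp
  qed (auto simp: L_def)
  have R: "c j \<in> R \<longleftrightarrow> {c (j - 1), c j} \<in> M" for j
  proof
    assume "c j \<in> R"
    then obtain k where "c j = c k" "{c (k - 1), c k} \<in> M" unfolding R_def by blast
    then show "{c (j - 1), c j} \<in> M" using c_shift_minus[of j k 1] by simp
  qed (auto simp: R_def)
  have L_max: "maximum_independent G (L \<union> {x \<in> verts G - range c. \<forall>y\<in>L. \<not> x \<rightarrow> y})"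
  proof (rule maximum_independent_sun[OF pm])
    show "False" if "c i \<in> L" "c (i + 1) \<in> L" for i
      using two[of "i + 1"] that by (simp add: L)
  qed (auto simp: L, auto simp: L_def)
  have R_max: "maximum_independent G (R \<union> {x \<in> verts G - range c. \<forall>y\<in>R. \<not> x \<rightarrow> y})"
  proof (rule maximum_independent_sun[OF pm])
    show "False" if "c i \<in> R" "c (i + 1) \<in> R" for i
      using two[of i] that by (simp add: R)
  qed (auto simp: R, auto simp: R_def)
  show ?thesis
    unfolding alpha_excellent_def
  proof
    fix v assume v: "v \<in> verts G"
    consider (pend) "v \<notin> range c" | (supp) i where "v = c i" "supp i"
      | (cyc) i where "v = c i" "\<not> supp i" by blast
    then show "\<exists>I. maximum_independent G I \<and> v \<in> I"
    proof cases
      case pend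
      have "\<not> v \<rightarrow> y" if "y \<in> L" for y
      proof
        assume "v \<rightarrow> y"
        moreover obtain j where "y = c j" "{c j, c (j + 1)} \<in> M"
          using \<open>y \<in> L\<close> unfolding L_def by blast
        ultimately show False
          using pend supp_not_matched_on_cycle(1)[OF pm, of j] unfolding supp_def by blast
      qed
      then show ?thesis using L_max pend v by blast
    next
      case (supp i)
      then show ?thesis
        using st ex_maximum_independent_supp[OF pm supp(2), of s]
          ex_maximum_independent_supp[OF pm supp(2), of t] by (cases "c s = c i") auto
    next
      case (cyc i)
      obtain y where y: "{c i, y} \<in> M" "c i \<rightarrow> y"
        using perfect_matching_cover[OF pm c_in_verts] .
      then have "y = c (i + 1) \<or> y = c (i - 1)" using nbrs_cycle cyc(2) by blast
      then have "v \<in> L \<or> v \<in> R" using y cyc(1) L R by (auto simp: insert_commute)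
      then show ?thesis using L_max R_max by blast
    qed
  qed
qed

section \<open>Excellence forces even segments and a perfect matching\<close>

lemma maximum_independent_avoid_supp:
  assumes max: "maximum_independent G I" and t: "supp t"
  obtains J where "maximum_independent G J" "c t \<notin> J" "I - {c t} \<subseteq> J"
proof (cases "c t \<in> I")
  \<comment> \<open>The vertex \<open>c t\<close> is traded for its leaf \<open>y\<close>, whose
    only neighbour it is.\<close>
  case True
  obtain y where y: "y \<notin> range c" "y \<rightarrow> c t" using t unfolding supp_def by blast
  have ind: "independent G I" using max by (simp add: maximum_independent_def)
  have "y \<notin> I" using ind True y unfolding independent_def by blast
  have yV: "y \<in> verts G" using y adj_in_verts by blast
  define J where "J = insert y (I - {c t})"
  have "independent G J"
    using ind yV y(1) unfolding independent_def J_def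
    by (auto simp: pendant_nbrs[OF y])
  moreover have "card J = card I"
    using True \<open>y \<notin> I\<close> independent_finite[OF ind] unfolding J_def
    by (metis DiffD1 card_insert_disjoint card_Suc_Diff1 finite_Diff)
  ultimately have "maximum_independent G J"
    using max maximum_independentI by simp
  moreover have "c t \<notin> J" using y(1) by (auto simp: J_def)
  ultimately show thesis using that[of J] by (auto simp: J_def)
qed (use that[of I] max in simp)

text \<open>
  Otherwise trade \<open>c s\<close> for its leaf, move the vertices of \<open>I\<close> among \<open>c (s + 1), \<dots>, c (s + j)\<close>
  one step towards \<open>c s\<close>, and add \<open>c (s + j)\<close>.
\<close>

lemma maximum_independent_shift:
  assumes max: "maximum_independent G I" and cs: "c s \<in> I" and s: "supp s"
    and j: "1 \<le> j" "j < n" and ns: "\<And>i. s < i \<Longrightarrow> i \<le> s + j \<Longrightarrow> \<not> supp i"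
    and cj: "c (s + j) \<notin> I"
  shows "j + 1 < n \<and> c (s + j + 1) \<in> I"
proof (rule ccontr)
  assume neg: "\<not> (j + 1 < n \<and> c (s + j + 1) \<in> I)"
  have ind: "independent G I" using max by (simp add: maximum_independent_def)
  obtain x where x: "x \<notin> range c" "x \<rightarrow> c s" using s unfolding supp_def by blast
  have xV: "x \<in> verts G" using x adj_in_verts by blast
  have "x \<notin> I" using ind cs x unfolding independent_def by blast
  have inj: "inj_on c {s..s + j}"
    using j by (intro inj_onI) (auto simp: c_eq_iff_window)
  have noadj: "\<not> (c i \<in> I \<and> c (i + 1) \<in> I)" for i
    using ind c_adj unfolding independent_def by blast
  \<comment> \<open>\<open>A\<close> holds the indices that move and \<open>A'\<close> the new
    places; \<open>B\<close> enters in exchange for \<open>D\<close> and has one element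
    more.\<close>
  define A where "A = {i. s < i \<and> i \<le> s + j \<and> c i \<in> I}"
  define A' where "A' = insert (s + j) ((\<lambda>i. i - 1) ` A)"
  define D where "D = c ` insert s A"
  define B where "B = insert x (c ` A')"
  have finA: "finite A" unfolding A_def by (rule finite_subset[of _ "{s..s + j}"]) auto
  \<comment> \<open>As \<open>c (s + 1)\<close> is adjacent to \<open>c s\<close>, the shift never
    reaches the place of \<open>c s\<close>.\<close>
  have s1: "s + 1 \<notin> A" using noadj[of s] cs by (auto simp: A_def)
  have A'_iff: "i \<in> A' \<longleftrightarrow> i = s + j \<or> s < i \<and> i < s + j \<and> c (i + 1) \<in> I" for i
  proof
    assume "i \<in> A'"
    then show "i = s + j \<or> s < i \<and> i < s + j \<and> c (i + 1) \<in> I"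
      using s1 by (auto simp: A'_def A_def) (smt (verit))
  next
    assume "i = s + j \<or> s < i \<and> i < s + j \<and> c (i + 1) \<in> I"
    then show "i \<in> A'"
      by (auto simp: A'_def A_def intro!: image_eqI[of _ _ "i + 1"])
  qed
  have A'_sub: "A' \<subseteq> {s + 1..s + j}" using j by (auto simp: A'_iff)
  have "s + j \<notin> (\<lambda>i. i - 1) ` A" by (auto simp: A_def)
  then have cardA': "card A' = Suc (card A)"
    using finA by (simp add: A'_def card_image inj_on_def)
  have cardD: "card D = Suc (card A)"
  proof -
    have "inj_on c (insert s A)"
      by (rule inj_on_subset[OF inj]) (use j in \<open>auto simp: A_def\<close>)
    then have "card D = card (insert s A)" unfolding D_def by (rule card_image)
    moreover have "s \<notin> A" by (simp add: A_def)
    ultimately show ?thesis using finA by simp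
  qed
  have cardB: "card B = Suc (Suc (card A))"
  proof -
    have "inj_on c A'"
      by (rule inj_on_subset[OF inj]) (use A'_sub in auto)
    then have "card (c ` A') = card A'" by (rule card_image)
    moreover have "x \<notin> c ` A'" using x by auto
    moreover have "finite A'" using A'_sub by (rule finite_subset) simp
    ultimately show ?thesis using cardA' by (simp add: B_def)
  qed
  define J where "J = I - D \<union> B"
  have cJ: "c i \<in> J \<longleftrightarrow> i \<in> A'" if "s \<le> i" "i \<le> s + j" for i
  proof
    assume "c i \<in> J"
    then consider "c i \<in> I" "c i \<notin> D" | "c i \<in> c ` A'" using x unfolding J_def B_def by auto
    then show "i \<in> A'"
    proof cases
      case 1
      then have "i = s \<or> i \<in> A" using that by (auto simp: A_def)
      with 1 show ?thesis unfolding D_def by blast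
    next
      case 2
      moreover have "A' \<subseteq> {s..s + j}" using A'_sub by auto
      ultimately show ?thesis using inj_on_image_mem_iff[OF inj, of i A'] that by simp
    qed
  qed (auto simp: J_def B_def)
  have csJ: "c s \<notin> J" using cJ[of s] j by (auto simp: A'_iff)
  \<comment> \<open>The critical index is \<open>s + j\<close>: its successor is either outside
    \<open>I\<close> by \<open>neg\<close> or, when \<open>j + 1 = n\<close>, the vertex
    \<open>c s\<close>, which has been removed.\<close>
  have no_next: "c (i + 1) \<notin> J" if "i \<in> A'" for i
  proof (cases "i = s + j")
    case True
    show ?thesis
    proof (cases "j + 1 < n")
      case True
      have "c (s + j + 1) \<noteq> c k" if "k \<in> A'" for k
        using that A'_sub True j by (subst c_eq_iff_window) auto
      then show ?thesis
        using neg True x \<open>i = s + j\<close> by (auto simp: J_def B_def)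
    next
      case False
      then have "i + 1 = s + n" using j \<open>i = s + j\<close> by simp
      then show ?thesis using csJ c_add_n[of s] by (simp only: not_False_eq_True)
    qed
  next
    case False
    then have "s < i" "i < s + j" "c (i + 1) \<in> I" using that by (auto simp: A'_iff)
    moreover from this have "i + 1 \<notin> A'"
      using noadj[of "i + 1"] cj by (auto simp: A'_iff)
    ultimately show ?thesis using cJ[of "i + 1"] by simp
  qed
  have no_prev: "c (i - 1) \<notin> J" if "i \<in> A'" for i
  proof
    assume "c (i - 1) \<in> J"
    moreover have "s \<le> i - 1" "i - 1 \<le> s + j" using that A'_sub by auto
    ultimately have "i - 1 \<in> A'" using cJ by blast
    with no_next[of "i - 1"] show False using that cJ[of i] A'_sub by auto
  qed
  have B_nbrs: "y \<notin> J" if "b \<in> B" "b \<rightarrow> y" for b y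
  proof -
    consider "b = x" | i where "i \<in> A'" "b = c i" using \<open>b \<in> B\<close> unfolding B_def by blast
    then show ?thesis
    proof cases
      case 1
      then have "y = c s" using that pendant_nbrs(1)[OF x, of y] by simp
      then show ?thesis using csJ by simp
    next
      case (2 i)
      then have "\<not> supp i" using ns A'_sub by auto
      then have "y = c (i + 1) \<or> y = c (i - 1)" using nbrs_cycle[of i y] that 2 by simp
      then show ?thesis using no_next[OF 2(1)] no_prev[OF 2(1)] by auto
    qed
  qed
  have "J \<subseteq> verts G"
    using ind xV c_in_verts unfolding J_def B_def independent_def by auto
  moreover have "\<not> a \<rightarrow> b" if "a \<in> J" "b \<in> J" for a b
  proof
    assume ab: "a \<rightarrow> b"
    then have "a \<notin> B" "b \<notin> B" using B_nbrs that graph_symmetric[OF ab] by blast+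
    then have "a \<in> I" "b \<in> I" using that unfolding J_def by auto
    then show False using ab ind unfolding independent_def by blast
  qed
  ultimately have indJ: "independent G (I - D \<union> B)" unfolding independent_def J_def by blast
  have "B \<inter> I \<subseteq> D"
  proof clarify
    fix b assume "b \<in> B" "b \<in> I"
    then obtain i where i: "i \<in> A'" "b = c i" using \<open>x \<notin> I\<close> unfolding B_def by auto
    then have "i \<in> A" using \<open>b \<in> I\<close> A'_sub by (auto simp: A_def)
    then show "b \<in> D" using i by (simp add: D_def)
  qed
  moreover have "D \<subseteq> I" using cs by (auto simp: D_def A_def)
  ultimately have "card B \<le> card D"
    using maximum_independent_exchange[OF max _ _ indJ] by blast
  then show False using cardB cardD by simp
qed

text \<open>Otherwise \<open>maximum_independent_shift\<close> applies with \<open>j = n - 1\<close>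
  to the whole rest of the cycle, whose last vertex is adjacent to \<open>c s\<close> and hence not
  in \<open>I\<close>; but then its conclusion \<open>j + 1 < n\<close> is false.\<close>

lemma alpha_excellent_ex_second_supp:
  assumes ex: "alpha_excellent G" and s: "supp s"
  shows "\<exists>t. s < t \<and> t < s + n \<and> supp t"
proof (rule ccontr)
  assume no: "\<not> (\<exists>t. s < t \<and> t < s + n \<and> supp t)"
  obtain I where I: "maximum_independent G I" "c s \<in> I"
    using ex c_in_verts unfolding alpha_excellent_def by blast
  have "c (s + (n - 1)) \<rightarrow> c s"
    using c_adj[of "s + (n - 1)"] c_add_n[of s] by (simp add: algebra_simps)
  then have "c (s + (n - 1)) \<notin> I"
    using I unfolding maximum_independent_def independent_def by blast
  moreover have "\<not> supp i" if "s < i" "i \<le> s + (n - 1)" for i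
    using no that by auto
  ultimately have "n - 1 + 1 < n"
    using maximum_independent_shift[OF I s, of "n - 1"] n_ge_3 by simp
  then show False by simp
qed

text \<open>Once \<open>c t\<close> is traded for a leaf, independence and
  \<open>maximum_independent_shift\<close> force \<open>I\<close> to alternate from
  \<open>c s\<close> up to \<open>c (t - 1)\<close>. For even \<open>t - s\<close> the vertex
  \<open>c (t - 1)\<close> would be missing from \<open>I\<close>, and one more application would
  put \<open>c t\<close> into \<open>I\<close>. Odd \<open>t - s\<close> means an even number of
  vertices strictly between.\<close>

lemma alpha_excellent_even_gap:
  assumes ex: "alpha_excellent G" and s: "supp s" and t: "supp t" and st: "s < t" "t < s + n"
    and gap: "\<And>i. s < i \<Longrightarrow> i < t \<Longrightarrow> \<not> supp i"
  shows "odd (t - s)"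
proof (rule ccontr)
  assume "\<not> odd (t - s)"
  have cst: "c s \<noteq> c t" using st by (subst c_eq_iff_window) auto
  obtain I0 where I0: "maximum_independent G I0" "c s \<in> I0"
    using ex c_in_verts unfolding alpha_excellent_def by blast
  obtain I where I: "maximum_independent G I" "c t \<notin> I" "c s \<in> I"
    using maximum_independent_avoid_supp[OF I0(1) t] I0(2) cst by blast
  have parity: "c (s + int k) \<in> I \<longleftrightarrow> even k" if "s + int k < t" for k
    using that
  proof (induction k)
    case (Suc k)
    then have IH: "c (s + int k) \<in> I \<longleftrightarrow> even k" by simp
    show ?case
    proof (cases "even k")
      case True
      then have "c (s + int k) \<in> I" using IH by simp
      moreover have "c (s + int k) \<rightarrow> c (s + int (Suc k))"
        using c_adj[of "s + int k"] by (simp add: algebra_simps)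
      ultimately have "c (s + int (Suc k)) \<notin> I"
        using I(1) unfolding maximum_independent_def independent_def by blast
      with True show ?thesis by simp
    next
      case False
      then have "c (s + int k + 1) \<in> I"
        using maximum_independent_shift[OF I(1,3) s, of "int k"] IH Suc.prems st gap
        by (cases k) auto
      with False show ?thesis by (simp add: algebra_simps)
    qed
  qed (use I in simp)
  define k where "k = nat (t - s - 1)"
  have k: "s + int k = t - 1" using st by (simp add: k_def)
  have "odd k" using \<open>\<not> odd (t - s)\<close> st by (simp add: k_def even_nat_iff)
  then have "c (s + int k) \<notin> I" "1 \<le> int k" using parity[of k] k by (auto elim: oddE)
  then have "c (s + int k + 1) \<in> I"
    using maximum_independent_shift[OF I(1,3) s, of "int k"] k st gap by simp
  then show False using I(2) k by simp
qed

text \<open>All legs are taken, and the vertices between consecutive support vertices are paired off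
  from the start of each segment; by \<open>alpha_excellent_even_gap\<close> no vertex is left
  over.\<close>

lemma alpha_excellent_imp_perfect_matching:
  assumes ex: "alpha_excellent G" and s0: "supp s0"
  shows "\<exists>M. perfect_matching G M"
proof -
  \<comment> \<open>\<open>P s i\<close> makes \<open>s\<close> the last support index up to
    \<open>i\<close>, and \<open>X i\<close> selects the edge from \<open>c i\<close> to
    \<open>c (i + 1)\<close> when \<open>i\<close> is at odd distance from that index.\<close>
  define P where "P s i \<longleftrightarrow> supp s \<and> s \<le> i \<and> (\<forall>k. s < k \<longrightarrow> k \<le> i \<longrightarrow> \<not> supp k)" for s i
  define X where "X i \<longleftrightarrow> (\<exists>s. P s i \<and> odd (i - s))" for i
  have P_unique: "s = t" if "P s i" "P t i" for s t i
    using that unfolding P_def by (meson linorder_less_linear)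
  have P_ex: "\<exists>s. P s i" for i
  proof -
    \<comment> \<open>Any \<open>n\<close> consecutive indices contain a copy of \<open>s0\<close>,
      so the search backwards from \<open>i\<close> ends.\<close>
    obtain t where t: "i + 1 - n \<le> t" "t < i + 1 - n + n" "c t = c s0" using c_window .
    then have t': "supp t" "t \<le> i" using s0 supp_cong[OF t(3)] by simp_all
    define d where "d = (LEAST d. supp (i - int d))"
    have ex: "supp (i - int (nat (i - t)))" using t' by simp
    have d: "supp (i - int d)" unfolding d_def by (rule LeastI[of "\<lambda>d. supp (i - int d)", OF ex])
    have "\<not> supp k" if "i - int d < k" "k \<le> i" for k
    proof
      assume "supp k"
      then have "supp (i - int (nat (i - k)))" using that by simp
      then have "d \<le> nat (i - k)" unfolding d_def by (rule Least_le)
      then show False using that by simp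
    qed
    with d show ?thesis unfolding P_def by (intro exI[of _ "i - int d"]) auto
  qed
  have P_cong: "P (s + (j - i)) j" if "P s i" "c i = c j" for s i j
  proof -
    have "c (k + (j - i)) = c k" for k
      using c_shift[OF that(2), of "k - i"] by (simp add: algebra_simps)
    then have eq: "supp (k + (j - i)) \<longleftrightarrow> supp k" for k by (rule supp_cong)
    have "\<not> supp k" if "s + (j - i) < k" "k \<le> j" for k
      using that eq[of "k - (j - i)"] \<open>P s i\<close> unfolding P_def by auto
    then show ?thesis using that(1) eq[of s] unfolding P_def by auto
  qed
  have X_cong: "X j" if "X i" "c i = c j" for i j
  proof -
    obtain s where "P s i" "odd (i - s)" using \<open>X i\<close> unfolding X_def by blast
    then have "P (s + (j - i)) j" using P_cong that(2) by blast
    moreover have "odd (j - (s + (j - i)))" using \<open>odd (i - s)\<close> by simp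
    ultimately show ?thesis unfolding X_def by blast
  qed
  have X_not_supp: "\<not> supp i" "\<not> supp (i + 1)" if "X i" for i
  proof -
    obtain s where s: "P s i" "odd (i - s)" using \<open>X i\<close> unfolding X_def by blast
    then have "s \<noteq> i" by auto
    then show "\<not> supp i" using s unfolding P_def by auto
    show "\<not> supp (i + 1)"
    proof
      assume i1: "supp (i + 1)"
      \<comment> \<open>The second support vertex bounds \<open>i + 1\<close> by
        \<open>t < s + n\<close>, as the parity of the gap requires.\<close>
      obtain t where t: "s < t" "t < s + n" "supp t"
        using alpha_excellent_ex_second_supp[OF ex] s unfolding P_def by blast
      then have "\<not> t \<le> i" using s unfolding P_def by blast
      then have "odd (i + 1 - s)"
        using s i1 t by (intro alpha_excellent_even_gap[OF ex]) (auto simp: P_def)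
      with s show False by simp
    qed
  qed
  have X_alt: "\<not> X (i + 1)" if "X i" for i
  proof
    assume "X (i + 1)"
    obtain s where s: "P s i" "odd (i - s)" using \<open>X i\<close> unfolding X_def by blast
    obtain t where t: "P t (i + 1)" "odd (i + 1 - t)" using \<open>X (i + 1)\<close> unfolding X_def by blast
    \<comment> \<open>As \<open>i + 1\<close> is no support index, \<open>i\<close> and
      \<open>i + 1\<close> share the last support index, and their distances to it differ in
      parity.\<close>
    have "t \<noteq> i + 1" using t X_not_supp(2)[OF \<open>X i\<close>] unfolding P_def by blast
    then have "P t i" using t unfolding P_def by auto
    then have "s = t" using P_unique s(1) by blast
    with s t show False by simp
  qed
  have X_cover: "X i \<or> X (i - 1)" if "\<not> supp i" for i
  proof -
    obtain s where s: "P s i" using P_ex by blast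
    then have "s \<noteq> i" using that unfolding P_def by auto
    then have "P s (i - 1)" using s unfolding P_def by auto
    with s show ?thesis unfolding X_def by (cases "odd (i - s)") auto
  qed
  define E1 where "E1 = {{x, c i} | x i. x \<notin> range c \<and> x \<rightarrow> c i}"
  define E2 where "E2 = {{c i, c (i + 1)} | i. X i}"
  have LC: "disjnt e f" if "e \<in> E1" "f \<in> E2" for e f
  proof -
    obtain x i where e: "e = {x, c i}" "x \<notin> range c" "supp i"
      using \<open>e \<in> E1\<close> unfolding E1_def supp_def by blast
    obtain j where f: "f = {c j, c (j + 1)}" "X j" using \<open>f \<in> E2\<close> unfolding E2_def by blast
    have "c i \<noteq> c j" "c i \<noteq> c (j + 1)"
      using e(3) X_not_supp[OF f(2)] supp_cong[of i j] supp_cong[of i "j + 1"] by auto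
    then show ?thesis using e(2) unfolding disjnt_def e(1) f(1) by auto
  qed
  have LL: "disjnt e f" if "e \<in> E1" "f \<in> E1" "e \<noteq> f" for e f
  proof -
    obtain x i where e: "e = {x, c i}" "x \<notin> range c" "x \<rightarrow> c i"
      using \<open>e \<in> E1\<close> unfolding E1_def by blast
    obtain y j where f: "f = {y, c j}" "y \<notin> range c" "y \<rightarrow> c j"
      using \<open>f \<in> E1\<close> unfolding E1_def by blast
    have "x \<noteq> y"
    proof
      assume "x = y"
      then have "c j = c i" using pendant_nbrs(1)[OF e(2,3), of "c j"] f(3) by simp
      then show False using e(1) f(1) \<open>x = y\<close> \<open>e \<noteq> f\<close> by simp
    qed
    \<comment> \<open>Here excellence enters: a vertex carries at most one leaf.\<close>
    moreover have "x = y" if "c i = c j"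
      using alpha_excellent_unique_leaf[OF ex, of x "c i" y]
        pendant_nbrs(1)[OF e(2,3)] pendant_nbrs(1)[OF f(2,3)] that by simp
    ultimately show ?thesis using e(2) f(2) unfolding disjnt_def e(1) f(1) by auto
  qed
  have CC: "disjnt e f" if "e \<in> E2" "f \<in> E2" "e \<noteq> f" for e f
  proof -
    obtain i where e: "e = {c i, c (i + 1)}" "X i" using \<open>e \<in> E2\<close> unfolding E2_def by blast
    obtain j where f: "f = {c j, c (j + 1)}" "X j" using \<open>f \<in> E2\<close> unfolding E2_def by blast
    have 1: "c i \<noteq> c j" using c_shift[of i j 1] e f that(3) by auto
    moreover have "c (i + 1) \<noteq> c (j + 1)" using c_shift[of "i + 1" "j + 1" "-1"] 1 by auto
    moreover have "c i \<noteq> c (j + 1)" using X_cong[OF e(2)] X_alt[OF f(2)] by blast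
    moreover have "c (i + 1) \<noteq> c j" using X_cong[OF f(2), of "i + 1"] X_alt[OF e(2)] by auto
    ultimately show ?thesis unfolding disjnt_def e(1) f(1) by auto
  qed
  have "perfect_matching G (E1 \<union> E2)"
    unfolding perfect_matching_def
  proof (intro conjI)
    show "E1 \<union> E2 \<subseteq> edges G"
      using c_adj unfolding E1_def E2_def edges_def by blast
    show "pairwise disjnt (E1 \<union> E2)"
      unfolding pairwise_def
    proof (intro ballI impI)
      fix e f assume "e \<in> E1 \<union> E2" "f \<in> E1 \<union> E2" "e \<noteq> f"
      then show "disjnt e f"
        using LL[of e f] CC[of e f] LC[of e f] LC[of f e] by (auto intro: disjnt_sym)
    qed
    show "\<Union> (E1 \<union> E2) = verts G"
    proof
      show "\<Union> (E1 \<union> E2) \<subseteq> verts G"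
        using c_in_verts adj_in_verts unfolding E1_def E2_def by blast
      show "verts G \<subseteq> \<Union> (E1 \<union> E2)"
      proof
        fix x assume x: "x \<in> verts G"
        consider (pend) "x \<notin> range c" | (supp) i where "x = c i" "supp i"
          | (cyc) i where "x = c i" "\<not> supp i" by blast
        then show "x \<in> \<Union> (E1 \<union> E2)"
        proof cases
          case pend
          then obtain i where "x \<rightarrow> c i" using pendant[OF x] by blast
          then show ?thesis using pend unfolding E1_def by blast
        next
          case (supp i)
          then show ?thesis unfolding E1_def supp_def by blast
        next
          case (cyc i)
          have "{c i, c (i + 1)} \<in> E2 \<or> {c (i - 1), c i} \<in> E2"
            using X_cover[OF cyc(2)] unfolding E2_def by force
          then show ?thesis using cyc(1) by blast
        qed
      qed
    qed
  qed
  then show ?thesis ..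
qed

section \<open>Legs and support vertices\<close>

lemma card_legs_ge_2_iff:
  "2 \<le> card (legs G) \<longleftrightarrow> (\<exists>e\<in>legs G. \<exists>f\<in>legs G. e \<noteq> f)"
proof -
  have "finite (legs G)"
    by (rule finite_subset[of _ "Pow (verts G)"])
      (use adj_in_verts in \<open>auto simp: legs_def edges_def\<close>)
  then show ?thesis
    using card_le_Suc0_iff_eq[of "legs G"] by (auto simp: not_less_eq_eq numeral_2_eq_2)
qed

lemma alpha_excellent_legs_ge_2:
  assumes ex: "alpha_excellent G" and s: "supp s"
  shows "2 \<le> card (legs G)"
proof -
  obtain t where t: "s < t" "t < s + n" "supp t"
    using alpha_excellent_ex_second_supp[OF ex s] by blast
  have "c s \<noteq> c t" using t by (subst c_eq_iff_window) auto
  obtain x where x: "x \<notin> range c" "x \<rightarrow> c s" using s unfolding supp_def by blast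
  obtain y where y: "y \<notin> range c" "y \<rightarrow> c t" using t(3) unfolding supp_def by blast
  have "c s \<noteq> y" using y(1) by blast
  with \<open>c s \<noteq> c t\<close> have "c s \<notin> {y, c t}" by simp
  then have "{x, c s} \<noteq> {y, c t}" by (metis insertI1 insert_commute)
  moreover have "{x, c s} \<in> legs G"
    unfolding legs_eq mem_Collect_eq using x by (intro exI[of _ x] exI[of _ s] conjI refl)
  moreover have "{y, c t} \<in> legs G"
    unfolding legs_eq mem_Collect_eq using y by (intro exI[of _ y] exI[of _ t] conjI refl)
  ultimately show ?thesis
    unfolding card_legs_ge_2_iff
    by (intro bexI[of _ "{x, c s}"] bexI[of _ "{y, c t}"])
qed

text \<open>Legs belong to every perfect matching, so two distinct legs share no support
  vertex.\<close>

lemma legs_ge_2_supp: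
  assumes pm: "perfect_matching G M" and legs: "2 \<le> card (legs G)"
  obtains s t where "supp s" "supp t" "c s \<noteq> c t"
proof -
  obtain e f where ef: "e \<in> legs G" "f \<in> legs G" "e \<noteq> f"
    using legs unfolding card_legs_ge_2_iff by blast
  obtain x s where x: "e = {x, c s}" "x \<notin> range c" "x \<rightarrow> c s" using ef unfolding legs_eq by blast
  obtain y t where y: "f = {y, c t}" "y \<notin> range c" "y \<rightarrow> c t" using ef unfolding legs_eq by blast
  have "e \<in> M" "f \<in> M" using pendant_matched[OF pm] x y by blast+
  then have "c s \<noteq> c t" using perfect_matching_unique[OF pm, of e f "c s"] ef(3) x y by blast
  then show thesis using that x y unfolding supp_def by blast
qed

section \<open>Suns without support vertices\<close>

lemma alpha_excellent_if_no_supp: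
  assumes "\<And>i. \<not> supp i"
  shows "alpha_excellent G"
  unfolding alpha_excellent_def
proof
  fix v assume v: "v \<in> verts G"
  have V: "verts G = range c"
    using pendant assms c_in_verts unfolding supp_def by blast
  obtain I where I: "maximum_independent G I" using ex_maximum_independent by blast
  then have ind: "independent G I" by (simp add: maximum_independent_def)
  have "independent G {v}" using v adj_not_same unfolding independent_def by blast
  then have "card I \<noteq> 0" using I unfolding maximum_independent_def by force
  then obtain w where w: "w \<in> I" by (metis card.empty equals0I)
  obtain i j where i: "v = c i" and j: "w = c j"
    using V v w ind unfolding independent_def by blast
  \<comment> \<open>The graph is now a bare cycle and can be rotated: \<open>J\<close> is
    \<open>I\<close> turned so that \<open>w = c j\<close> moves to \<open>v = c i\<close>.\<close>
  define J where "J = c ` {k. c (k + (j - i)) \<in> I}"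
  have J: "c k \<in> J \<longleftrightarrow> c (k + (j - i)) \<in> I" for k
  proof
    assume "c k \<in> J"
    then obtain m where "c k = c m" "c (m + (j - i)) \<in> I" unfolding J_def by blast
    then show "c (k + (j - i)) \<in> I" using c_shift[of k m "j - i"] by simp
  qed (simp add: J_def)
  have rot: "c (k + (j - i)) \<rightarrow> c (m + (j - i))" if km: "c k \<rightarrow> c m" for k m
  proof -
    have "c m = c (k + 1) \<or> c m = c (k - 1)" using km by (rule chordless)
    then have "c (m + (j - i)) = c (k + (j - i) + 1) \<or> c (m + (j - i)) = c (k + (j - i) - 1)"
      using c_shift[of m "k + 1" "j - i"] c_shift[of m "k - 1" "j - i"] by (auto simp: algebra_simps)
    then show ?thesis using c_adj[of "k + (j - i)"] c_adj'(1)[of "k + (j - i)"] by auto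
  qed
  have indJ: "independent G J"
    unfolding independent_def
  proof (intro conjI ballI)
    fix a b assume ab: "a \<in> J" "b \<in> J"
    then obtain k m where "a = c k" "b = c m" unfolding J_def by blast
    then show "\<not> a \<rightarrow> b" using ab rot ind J unfolding independent_def by blast
  qed (auto simp: J_def c_in_verts)
  have "I \<subseteq> range c" using V ind unfolding independent_def by simp
  then have "\<exists>k. c k = a" if "a \<in> I" for a using that by auto
  then obtain g where g: "\<And>a. a \<in> I \<Longrightarrow> c (g a) = a" by metis
  have "card I \<le> card J"
  proof (rule card_inj_on_le[of "\<lambda>a. c (g a - (j - i))"])
    show "inj_on (\<lambda>a. c (g a - (j - i))) I"
    proof (rule inj_onI)
      fix a b assume "a \<in> I" "b \<in> I" "c (g a - (j - i)) = c (g b - (j - i))"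
      then show "a = b" using g c_shift[of "g a - (j - i)" "g b - (j - i)" "j - i"] by simp
    qed
    show "(\<lambda>a. c (g a - (j - i))) ` I \<subseteq> J" using g by (auto simp: J)
    show "finite J" using indJ by (rule independent_finite)
  qed
  then have "maximum_independent G J" using maximum_independentI I indJ by blast
  moreover have "v \<in> J" using w by (simp add: i j J)
  ultimately show "\<exists>J. maximum_independent G J \<and> v \<in> J" by blast
qed

end

section \<open>Unicyclic graphs\<close>

locale unique_cycle = graph +
  fixes C
  assumes cycle_of_iff: "cycle_of G D \<longleftrightarrow> D = C"
begin

lemma subgraph_C: "subgraph C G" and cycle_graph_C: "cycle_graph C"
  using cycle_of_iff[of C] by (simp_all add: cycle_of_def)

lemma verts_C_subset: "verts C \<subseteq> verts G"
  using subgraph_C by auto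

text \<open>Distinct neighbours joined inside \<open>S\<close> would close a cycle through
  \<open>x\<close>, but the only cycle \<open>C\<close> misses \<open>x\<close>.\<close>

lemma nbr_unique:
  assumes "S \<subseteq> verts G" "a \<rightarrow>\<^sup>*\<^bsub>G \<restriction> S\<^esub> b" "x \<notin> S" "x \<notin> verts C" "x \<rightarrow> a" "x \<rightarrow> b"
  shows "a = b"
proof (rule ccontr)
  assume "a \<noteq> b"
  then obtain D where "cycle_of G D" "x \<in> verts D"
    using cycle_through_two_nbrs[OF assms(1,2) _ assms(3,5,6)] by blast
  then show False using cycle_of_iff assms(4) by simp
qed

lemma enum_C:
  obtains n :: int and c where "3 \<le> n" "\<And>i j. c i = c j \<longleftrightarrow> i mod n = j mod n"
    "verts C = range c" "\<And>i. c i \<rightarrow>\<^bsub>C\<^esub> c (i + 1)" "\<And>i. c i \<rightarrow> c (i + 1)"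
proof -
  obtain n :: int and c where c: "3 \<le> n" "\<And>i j. c i = c j \<longleftrightarrow> i mod n = j mod n"
    "verts C = range c"
    "\<And>x y. x \<rightarrow>\<^bsub>C\<^esub> y \<longleftrightarrow> (\<exists>i. x = c i \<and> y = c (i + 1) \<or> y = c i \<and> x = c (i + 1))"
    by (rule cycle_graph_enum[OF cycle_graph_C]) (rule that)
  have adj: "c i \<rightarrow>\<^bsub>C\<^esub> c (i + 1)" for i using c(4) by blast
  show thesis
    by (rule that[OF c(1-3)]) (use adj adj_mono[OF adj subgraph_C] in auto)
qed

lemma reachable_along:
  fixes c :: "int \<Rightarrow> 'a"
  assumes adj: "\<And>i. c i \<rightarrow> c (i + 1)" and S: "\<And>k. i \<le> k \<Longrightarrow> k \<le> j \<Longrightarrow> c k \<in> S" and "i \<le> j"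
  shows "c i \<rightarrow>\<^sup>*\<^bsub>G \<restriction> S\<^esub> c j"
proof -
  interpret S: wf_digraph "G \<restriction> S" by (rule wellformed_induce_subgraph)
  from \<open>i \<le> j\<close> S show ?thesis
  proof (induction j rule: int_ge_induct)
    case base
    then show ?case by auto
  next
    case (step k)
    then have "c i \<rightarrow>\<^sup>*\<^bsub>G \<restriction> S\<^esub> c k" by simp
    moreover have "c k \<rightarrow>\<^bsub>G \<restriction> S\<^esub> c (k + 1)" using adj step.prems step.hyps by simp
    ultimately show ?case by (rule S.reachable_adj_trans)
  qed
qed

lemma reachable_in_C:
  assumes "a \<in> verts C" "b \<in> verts C"
  shows "a \<rightarrow>\<^sup>*\<^bsub>G \<restriction> verts C\<^esub> b"
proof -
  obtain n :: int and c where c: "3 \<le> n" "\<And>i j. c i = c j \<longleftrightarrow> i mod n = j mod n"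
    "verts C = range c" "\<And>i. c i \<rightarrow> c (i + 1)"
    by (rule enum_C) (rule that)
  obtain i j where ij: "a = c i" "b = c j" using assms c(3) by blast
  have "c i \<rightarrow>\<^sup>*\<^bsub>G \<restriction> verts C\<^esub> c (i + (j - i) mod n)"
    by (rule reachable_along) (use c in auto)
  moreover have "c (i + (j - i) mod n) = c j" unfolding c(2) by (simp add: mod_add_right_eq)
  ultimately show ?thesis using ij by simp
qed

text \<open>A chord would close a cycle avoiding a vertex of \<open>C\<close>.\<close>

lemma sun_if_pendant:
  assumes pend: "\<And>x. x \<in> verts G \<Longrightarrow> x \<notin> verts C \<Longrightarrow> \<exists>y\<in>verts C. \<forall>z. x \<rightarrow> z \<longleftrightarrow> z = y"
  obtains n c where "sun G n c" "verts C = range c" "\<And>i. c i \<rightarrow>\<^bsub>C\<^esub> c (i + 1)"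
proof -
  obtain n :: int and c where n: "3 \<le> n" and inj: "\<And>i j. c i = c j \<longleftrightarrow> i mod n = j mod n"
    and V: "verts C = range c" and adjC: "\<And>i. c i \<rightarrow>\<^bsub>C\<^esub> c (i + 1)" and adj: "\<And>i. c i \<rightarrow> c (i + 1)"
    by (rule enum_C) (rule that)
  have window: "c i = c j \<longleftrightarrow> i = j" if "\<bar>i - j\<bar> < n" for i j
    unfolding inj using dvd_imp_le_int[of "i - j" n] n that by (auto simp: mod_eq_dvd_iff)
  have chordless: "c j = c (i + 1) \<or> c j = c (i - 1)" if "c i \<rightarrow> c j" for i j
  proof (rule ccontr)
    assume no: "\<not> ?thesis"
    \<comment> \<open>\<open>k\<close> is the index of \<open>c j\<close> in the window starting at
      \<open>i\<close>.\<close>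
    define k where "k = i + (j - i) mod n"
    have k: "c k = c j" unfolding inj k_def by (simp add: mod_add_right_eq)
    have "c (i - 1) = c (i + n - 1)" unfolding inj by (simp add: mod_eq_dvd_iff)
    then have "k \<noteq> i" "k \<noteq> i + 1" "k \<noteq> i + n - 1"
      using no k that adj_not_same by auto
    moreover have "i \<le> k" "k < i + n" using n by (auto simp: k_def)
    ultimately have ik: "i + 1 < k" "k < i + n - 1" by auto
    \<comment> \<open>\<open>S\<close> is the segment of the cycle from \<open>c (i + 1)\<close> to
      the other end \<open>c k\<close> of the chord; closed up through \<open>c i\<close> it would
      contain a cycle missing \<open>c (i + n - 1)\<close>.\<close>
    define S where "S = c ` {i + 1..k}"
    have notS: "c m \<notin> S" if "k < m" "m \<le> i + n" for m
    proof
      assume "c m \<in> S"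
      then obtain l where "i + 1 \<le> l" "l \<le> k" "c m = c l" unfolding S_def by auto
      then show False using that window[of m l] by auto
    qed
    have ci: "c i = c (i + n)" unfolding inj by simp
    have "c (i + 1) = c k"
    proof (rule ccontr)
      assume ne: "c (i + 1) \<noteq> c k"
      have "\<exists>D. cycle_of G D \<and> c i \<in> verts D \<and> verts D \<subseteq> insert (c i) S"
      proof (rule cycle_through_two_nbrs[OF _ _ ne])
        show "S \<subseteq> verts G" using V verts_C_subset by (auto simp: S_def)
        show "c (i + 1) \<rightarrow>\<^sup>*\<^bsub>G \<restriction> S\<^esub> c k"
          by (rule reachable_along) (use adj ik in \<open>auto simp: S_def\<close>)
        show "c i \<notin> S" using notS[of "i + n"] ci ik by simp
      qed (use adj k that in simp_all)
      then have "range c \<subseteq> insert (c i) S" using V cycle_of_iff by auto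
      then have "c (i + n - 1) \<in> insert (c i) S" by blast
      moreover have "c (i + n - 1) \<noteq> c i" using n window[of "i + n - 1" "i + n"] ci by simp
      ultimately show False using notS[of "i + n - 1"] ik by simp
    qed
    then show False using no k by simp
  qed
  have "sun G n c"
  proof unfold_locales
    show "\<exists>i. \<forall>y. x \<rightarrow> y \<longleftrightarrow> y = c i" if "x \<in> verts G" "x \<notin> range c" for x
      using pend[of x] that V by auto
  qed (use n inj adj chordless in auto)
  then show thesis using that V adjC by blast
qed

text \<open>Every edge meets \<open>C\<close>, so all neighbours of \<open>x\<close> lie on
  \<open>C\<close>; connectedness provides one, and two would close a second cycle.\<close>

lemma caterpillar_wheel_pendant:
  assumes cat: "caterpillar_wheel G" and x: "x \<in> verts G" "x \<notin> verts C"
  shows "\<exists>y\<in>verts C. \<forall>z. x \<rightarrow> z \<longleftrightarrow> z = y"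
proof -
  have conn: "connected G" and meets: "\<And>e. e \<in> edges G \<Longrightarrow> e \<inter> verts C \<noteq> {}"
    using cat cycle_of_iff unfolding caterpillar_wheel_def by blast+
  have nbr: "y \<in> verts C" if "x \<rightarrow> y" for y
    using meets[of "{x, y}"] that x unfolding edges_def by blast
  have "verts C \<noteq> {}" by (rule enum_C) auto
  then obtain v where "v \<in> verts C" by blast
  then have "v \<in> verts G" "v \<noteq> x" using x verts_C_subset by auto
  then have "{x} \<noteq> verts G" by auto
  then obtain y where y: "x \<rightarrow> y"
    using connected_imp_closed_eq_verts[OF conn sym_arcs, of "{x}"] x by auto
  have "z = y" if "x \<rightarrow> z" for z
    by (rule nbr_unique[OF verts_C_subset]) (use that y nbr x in \<open>auto intro: reachable_in_C\<close>)
  then show ?thesis using y nbr by blast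
qed

text \<open>If there are non-leaves off \<open>C\<close>, an outermost one, \<open>u\<close>, is
  found by enlarging \<open>C\<close> to a connected set of non-leaves until only \<open>u\<close>
  is missing. The neighbours of \<open>u\<close> are then one vertex of that set and leaves, of
  which excellence allows just one, so \<open>u\<close> could be plucked.\<close>

lemma fully_plucked_alpha_excellent_pendant:
  assumes conn: "connected G" and ex: "alpha_excellent G" and np: "\<And>K. \<not> pluck G K"
    and x: "x \<in> verts G" "x \<notin> verts C"
  shows "\<exists>y\<in>verts C. \<forall>z. x \<rightarrow> z \<longleftrightarrow> z = y"
proof -
  define L where "L = {v \<in> verts G. out_degree G v = 1}"
  define conn_set where "conn_set S \<longleftrightarrow> (\<forall>a\<in>S. \<forall>b\<in>S. a \<rightarrow>\<^sup>*\<^bsub>G \<restriction> S\<^esub> b)" for S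
  have leaf_eq: "y = z" if v: "v \<in> L" and yz: "v \<rightarrow> y" "v \<rightarrow> z" for v y z
  proof -
    obtain w where "\<And>y. v \<rightarrow> y \<longleftrightarrow> y = w"
      using v unfolding L_def out_degree_eq_1_iff by blast
    with yz show ?thesis by simp
  qed
  have C_L: "verts C \<inter> L = {}"
  proof (rule ccontr)
    assume "verts C \<inter> L \<noteq> {}"
    then obtain v where v: "v \<in> verts C" "v \<in> L" by blast
    have "cycle_of G C" using cycle_of_iff by simp
    then obtain y z where "y \<noteq> z" "v \<rightarrow> y" "v \<rightarrow> z"
      using v(1) by (rule cycle_of_two_nbrs) (rule that)
    then show False using leaf_eq[OF v(2)] by blast
  qed
  have C_ne: "verts C \<noteq> {}" by (rule enum_C) auto
  have "verts G - L = verts C"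
  proof (rule ccontr)
    assume ne: "verts G - L \<noteq> verts C"
    define F where "F = {S. verts C \<subseteq> S \<and> S \<subset> verts G - L \<and> conn_set S}"
    have "finite F" by (rule finite_subset[of _ "Pow (verts G)"]) (auto simp: F_def)
    moreover have "verts C \<in> F"
      using ne C_L verts_C_subset reachable_in_C by (auto simp: F_def conn_set_def)
    ultimately obtain S where S: "S \<in> F" and S_max: "\<And>T. T \<in> F \<Longrightarrow> S \<subseteq> T \<Longrightarrow> S = T"
      using finite_has_maximal[of F] by blast
    have CS: "verts C \<subseteq> S" and SL: "S \<subset> verts G - L" and cs: "conn_set S"
      using S by (auto simp: F_def)
    \<comment> \<open>Otherwise \<open>S\<close> with its attached leaves is closed under adjacency,
      hence everything, and \<open>S\<close> would contain all non-leaves.\<close>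
    have "\<exists>s\<in>S. \<exists>v. s \<rightarrow> v \<and> v \<notin> S \<and> v \<notin> L"
    proof (rule ccontr)
      assume no: "\<not> ?thesis"
      define T where "T = S \<union> {v \<in> L. \<exists>s\<in>S. v \<rightarrow> s}"
      have "T = verts G"
      proof (rule connected_imp_closed_eq_verts[OF conn sym_arcs])
        fix a b assume a: "a \<in> T" and ab: "a \<rightarrow> b"
        show "b \<in> T"
        proof (cases "a \<in> S")
          case True
          then show ?thesis using no ab graph_symmetric[OF ab] unfolding T_def by blast
        next
          case False
          then obtain s where "a \<in> L" "s \<in> S" "a \<rightarrow> s" using a unfolding T_def by blast
          then show ?thesis using leaf_eq[of a b s] ab unfolding T_def by simp
        qed
      qed (use SL CS C_ne in \<open>auto simp: T_def L_def\<close>)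
      then show False using SL unfolding T_def by blast
    qed
    then obtain s u where su: "s \<in> S" "s \<rightarrow> u" "u \<notin> S" "u \<notin> L" by blast
    have us: "u \<rightarrow> s" using su(2) by (rule graph_symmetric)
    have uV: "u \<in> verts G" using us adj_in_verts by blast
    have "conn_set (insert u S)"
    proof -
      interpret I: wf_digraph "G \<restriction> insert u S" by (rule wellformed_induce_subgraph)
      have sub: "a \<rightarrow>\<^sup>*\<^bsub>G \<restriction> insert u S\<^esub> b" if "a \<in> S" "b \<in> S" for a b
        using cs that reachable_induce_ss[of S a b "insert u S"] unfolding conn_set_def by blast
      have su': "s \<rightarrow>\<^bsub>G \<restriction> insert u S\<^esub> u" "u \<rightarrow>\<^bsub>G \<restriction> insert u S\<^esub> s"
        using su us by auto
      have "u \<rightarrow>\<^sup>*\<^bsub>G \<restriction> insert u S\<^esub> u" by auto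
      moreover have "a \<rightarrow>\<^sup>*\<^bsub>G \<restriction> insert u S\<^esub> u" if "a \<in> S" for a
        using sub[OF that su(1)] su'(1) by (rule I.reachable_adj_trans)
      moreover have "u \<rightarrow>\<^sup>*\<^bsub>G \<restriction> insert u S\<^esub> a" if "a \<in> S" for a
        using su'(2) sub[OF su(1) that] by (rule I.adj_reachable_trans)
      ultimately show ?thesis using sub unfolding conn_set_def by blast
    qed
    \<comment> \<open>By maximality of \<open>S\<close>, the connected set \<open>insert u S\<close>
      is no longer proper, so \<open>u\<close> is the last non-leaf.\<close>
    then have "\<not> insert u S \<subset> verts G - L"
      using S_max[of "insert u S"] su(3) CS unfolding F_def by blast
    then have Su: "insert u S = verts G - L" using SL su uV by blast
    have nbrs_S: "y = s" if "u \<rightarrow> y" "y \<in> S" for y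
      by (rule nbr_unique[of S y s u])
        (use that su us SL CS cs in \<open>auto simp: conn_set_def\<close>)
    have "out_degree G u \<noteq> 1" using su(4) uV by (simp add: L_def)
    then obtain v where v: "u \<rightarrow> v" "v \<noteq> s" using us unfolding out_degree_eq_1_iff by metis
    have leaf: "y \<in> L" if "u \<rightarrow> y" "y \<noteq> s" for y
    proof (rule ccontr)
      assume "y \<notin> L"
      then have "y \<in> insert u S" using Su adj_in_verts(2)[OF that(1)] by simp
      moreover have "y \<noteq> u" using that(1) adj_not_same by blast
      ultimately show False using nbrs_S[OF that(1)] that(2) by simp
    qed
    have leaf_nbr: "y \<rightarrow> z \<longleftrightarrow> z = u" if "u \<rightarrow> y" "y \<noteq> s" for y z
      using leaf_eq[OF leaf[OF that], of z u] graph_symmetric[OF that(1)] by auto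
    have uniq: "y = v" if "u \<rightarrow> y" "y \<noteq> s" for y
      using alpha_excellent_unique_leaf[OF ex leaf_nbr[OF that] leaf_nbr[OF v]] .
    have nbrs: "u \<rightarrow> y \<longleftrightarrow> y = s \<or> y = v" for y using us v(1) uniq by blast
    have "s \<notin> L" using su(1) SL by blast
    have sV: "s \<in> verts G" using us adj_in_verts by blast
    have vL: "v \<in> L" using leaf v by blast
    have "{w. u \<rightarrow> w \<and> out_degree G w = 1} = {v}"
    proof -
      have "out_degree G s \<noteq> 1" using \<open>s \<notin> L\<close> sV by (simp add: L_def)
      moreover have "out_degree G v = 1" using vL by (simp add: L_def)
      ultimately show ?thesis unfolding nbrs by auto
    qed
    moreover from this have "support_vertex G u"
      using uV unfolding support_vertex_def by blast
    moreover have "out_degree G u = 2"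
      using v(2) by (simp add: out_degree_eq_card_nbrs nbrs Collect_disj_eq)
    \<comment> \<open>Three vertices of the cycle together with \<open>u\<close> meet the order
      condition of \<open>pluck\<close>.\<close>
    moreover have "4 \<le> card (verts G)"
    proof -
      obtain n :: int and c where c: "3 \<le> n" "\<And>i j. c i = c j \<longleftrightarrow> i mod n = j mod n"
        "verts C = range c"
        by (rule enum_C) (rule that)
      have "card {c 0, c 1, c 2} = 3" using c(1) by (simp add: c(2))
      moreover have "u \<notin> {c 0, c 1, c 2}" using CS c(3) su(3) by blast
      ultimately have "card {u, c 0, c 1, c 2} = 4" by simp
      moreover have "{u, c 0, c 1, c 2} \<subseteq> verts G" using uV verts_C_subset c(3) by blast
      ultimately show ?thesis using card_mono[of "verts G" "{u, c 0, c 1, c 2}"] by simp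
    qed
    ultimately show False using np unfolding pluck_def by blast
  qed
  then have "x \<in> L" using x by blast
  then obtain y where y: "\<And>z. x \<rightarrow> z \<longleftrightarrow> z = y"
    unfolding L_def out_degree_eq_1_iff by blast
  \<comment> \<open>Otherwise \<open>y\<close> is a leaf too, and two adjacent leaves would make up
    the whole graph, leaving no place for the cycle.\<close>
  have "y \<in> verts C"
  proof (rule ccontr)
    assume "y \<notin> verts C"
    have xy: "x \<rightarrow> y" using y by blast
    have "y \<in> L"
      using \<open>verts G - L = verts C\<close> \<open>y \<notin> verts C\<close> adj_in_verts(2)[OF xy] by auto
    then have y': "z = x" if "y \<rightarrow> z" for z
      using leaf_eq[OF _ that graph_symmetric[OF xy]] by simp
    have "{x, y} = verts G"
    proof (rule connected_imp_closed_eq_verts[OF conn sym_arcs])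
      show "{x, y} \<subseteq> verts G" using adj_in_verts[OF xy] by simp
      show "b \<in> {x, y}" if "a \<in> {x, y}" "a \<rightarrow> b" for a b
        using that y[of b] y'[of b] by auto
    qed simp
    then have "verts C \<subseteq> {x, y}" using verts_C_subset by simp
    then show False using C_ne x(2) \<open>y \<notin> verts C\<close> by blast
  qed
  then show ?thesis using y by (intro bexI[of _ y]) auto
qed

section \<open>The characterisation for fully plucked graphs\<close>

lemma sun_caterpillar_wheel:
  assumes conn: "connected G" and s: "sun G n c" and V: "verts C = range c"
  shows "caterpillar_wheel G"
proof -
  interpret sun G n c by (rule s)
  \<comment> \<open>With a single cycle the infimum is taken over a singleton.\<close>
  have "girth G = card (verts C)"
    using cycle_of_iff unfolding girth_def by simp
  moreover have "3 \<le> card (verts C)"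
  proof -
    have "card {c 0, c 1, c 2} = 3" using n_ge_3 by (simp add: c_eq_iff)
    moreover have "finite (verts C)" using verts_C_subset by (rule finite_subset) simp
    ultimately show ?thesis using V card_mono[of "verts C" "{c 0, c 1, c 2}"] by auto
  qed
  moreover have "e \<inter> verts C \<noteq> {}" if "e \<in> edges G" for e
  proof -
    obtain x y where e: "e = {x, y}" "x \<rightarrow> y"
      using \<open>e \<in> edges G\<close> unfolding edges_def by blast
    from e(2) show ?thesis using e(1) V by (cases rule: adj_cases) auto
  qed
  moreover have "unicyclic G" unfolding unicyclic_def by (rule ex1I[of _ C]) (simp_all add: cycle_of_iff)
  ultimately show ?thesis
    unfolding caterpillar_wheel_def using conn graph_axioms cycle_of_iff by simp
qed

text \<open>Equality of digraphs also concerns the arcs as objects: an arc of \<open>G\<close> and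
  the arc of \<open>C\<close> with the same ends coincide because there are no parallel
  arcs.\<close>

lemma sun_eq_cycle:
  assumes s: "sun G n c" and V: "verts C = range c" and adjC: "\<And>i. c i \<rightarrow>\<^bsub>C\<^esub> c (i + 1)"
    and no_supp: "\<And>i. \<not> sun.supp G c i"
  shows "G = C"
proof -
  interpret sun G n c by (rule s)
  interpret C: graph C using cycle_graph_C by (simp add: cycle_graph_def)
  have comp: "tail G = tail C" "head G = head C" and arcs_C: "arcs C \<subseteq> arcs G"
    using subgraph_C by (auto simp: compatible_def)
  have "x \<in> range c" if x: "x \<in> verts G" for x
  proof (rule ccontr)
    assume "x \<notin> range c"
    moreover from this obtain i where "x \<rightarrow> c i" using pendant[OF x] by auto
    ultimately show False using no_supp[of i] unfolding supp_def by blast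
  qed
  then have "verts G = verts C" using verts_C_subset V by auto
  moreover have "arcs G \<subseteq> arcs C"
  proof
    fix e assume e: "e \<in> arcs G"
    then have te: "tail G e \<rightarrow> head G e" by (rule in_arcs_imp_in_arcs_ends)
    then have "tail G e \<rightarrow>\<^bsub>C\<^esub> head G e"
    proof (cases rule: adj_cases)
      case (out i)
      then show ?thesis using no_supp[of i] te unfolding supp_def by metis
    next
      case (inw i)
      then show ?thesis using no_supp[of i] graph_symmetric[OF te] unfolding supp_def by metis
    next
      case (fwd i)
      then show ?thesis using adjC by simp
    next
      case (bwd i)
      then show ?thesis using C.graph_symmetric[OF adjC] by simp
    qed
    then obtain e' where e': "e' \<in> arcs C" "tail C e' = tail G e" "head C e' = head G e"
      by (rule reachableE)
    then have "e' = e" using e arcs_C comp by (intro no_multi_arcs) (auto simp: arc_to_ends_def)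
    then show "e \<in> arcs C" using e' by simp
  qed
  ultimately show ?thesis using comp arcs_C by (intro pre_digraph.equality) auto
qed

text \<open>In either direction \<open>G\<close> is first seen to be a sun; the cycle is the case
  without support vertices, the caterpillar-wheel the case with some.\<close>

lemma alpha_excellent_iff:
  assumes conn: "connected G" and np: "\<And>K. \<not> pluck G K"
  shows "alpha_excellent G \<longleftrightarrow> cycle_graph G \<or>
    caterpillar_wheel G \<and> (\<exists>M. perfect_matching G M) \<and> 2 \<le> card (legs G)"
proof
  assume ex: "alpha_excellent G"
  obtain n c where s: "sun G n c" and V: "verts C = range c" and adjC: "\<And>i. c i \<rightarrow>\<^bsub>C\<^esub> c (i + 1)"
    by (rule sun_if_pendant[OF fully_plucked_alpha_excellent_pendant[OF conn ex np]]) (assumption | rule that)+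
  interpret sun G n c by (rule s)
  show "cycle_graph G \<or> caterpillar_wheel G \<and> (\<exists>M. perfect_matching G M) \<and> 2 \<le> card (legs G)"
  proof (cases "\<exists>i. supp i")
    case True
    then show ?thesis
      using sun_caterpillar_wheel[OF conn s V] alpha_excellent_imp_perfect_matching[OF ex]
        alpha_excellent_legs_ge_2[OF ex] by blast
  next
    case False
    then have "G = C" using sun_eq_cycle[OF s V adjC] by blast
    then show ?thesis using cycle_graph_C by simp
  qed
next
  assume "cycle_graph G \<or> caterpillar_wheel G \<and> (\<exists>M. perfect_matching G M) \<and> 2 \<le> card (legs G)"
  then show "alpha_excellent G"
  proof (elim disjE conjE exE)
    assume "cycle_graph G"
    \<comment> \<open>A cycle graph is a cycle of itself, so by uniqueness it is \<open>C\<close>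
      and has no vertex off the cycle.\<close>
    then have "cycle_of G G" by (simp add: cycle_of_def subgraph_refl)
    then have GC: "G = C" using cycle_of_iff by blast
    obtain n c where s: "sun G n c" and V: "verts C = range c"
      by (rule sun_if_pendant) (use GC in auto)
    interpret sun G n c by (rule s)
    have "\<not> supp i" for i
      using V GC adj_in_verts unfolding supp_def by metis
    then show ?thesis by (rule alpha_excellent_if_no_supp)
  next
    fix M assume cat: "caterpillar_wheel G" and M: "perfect_matching G M" and l: "2 \<le> card (legs G)"
    obtain n c where s: "sun G n c"
      by (rule sun_if_pendant[OF caterpillar_wheel_pendant[OF cat]]) (assumption | rule that)+
    interpret sun G n c by (rule s)
    obtain s t where "supp s" "supp t" "c s \<noteq> c t" using legs_ge_2_supp[OF M l] .
    then show ?thesis by (rule alpha_excellent_if_perfect_matching[OF M])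
  qed
qed

end

theorem theorem3p3:
  fixes G :: "('a,'b) pre_digraph"
  assumes "graph G" and "connected G" and "unicyclic G"
  shows "alpha_excellent G \<longleftrightarrow>
      cycle_graph (plucked_graph G) \<or>
      (caterpillar_wheel (plucked_graph G) \<and>
       (\<exists>M. perfect_matching (plucked_graph G) M) \<and>
       (\<exists>l::nat. l \<ge> 2 \<and> card (legs (plucked_graph G)) = l))"
proof -
  interpret graph G by (rule assms)
  define H where "H = plucked_graph G"
  \<comment> \<open>The chosen graph enters only through being reached by pluckings and admitting no
    further one, so the argument covers every order of plucking.\<close>
  have "fully_plucked G H"
    unfolding H_def plucked_graph_def by (rule someI_ex[OF ex_fully_plucked]) simp
  then have H: "pluck\<^sup>*\<^sup>* G H" "\<And>K. \<not> pluck H K" unfolding fully_plucked_def by blast+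
  have inv: "graph H" "connected H" "\<And>C. cycle_of H C \<longleftrightarrow> cycle_of G C"
    "alpha_excellent H \<longleftrightarrow> alpha_excellent G"
    using rtranclp_pluck_invariant[OF H(1) assms(1,2)] by blast+
  obtain C where "\<And>D. cycle_of G D \<longleftrightarrow> D = C" using assms(3) unfolding unicyclic_def by metis
  then interpret H: unique_cycle H C
    using inv unfolding unique_cycle_def unique_cycle_axioms_def by simp
  show ?thesis
    using H.alpha_excellent_iff[OF inv(2) H(2)] inv(4) unfolding H_def by simp
qed

end
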